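(* Let $u_0\in\mathcal{B}_2(\mathbb{R})$. The following Strichartz estimates hold: $$\|e^{it\partial_x^2}u_0\|_{\mathcal{L}^4_{t,x}(\mathbb{R}\times\mathbb{R})}\lesssim\|u_0\|_{\mathcal{L}^2_x(\mathbb{R})},\qquad \|e^{t\partial_x^3}u_0\|_{\mathcal{L}^4_{t,x}(\mathbb{R}\times\mathbb{R})}\lesssim\|u_0\|_{\mathcal{L}^2_x(\mathbb{R})}.$$
   Context: $A\lesssim B$ means $A\le KB$ with a constant $K$ independent of $u_0$. For $1\le p<\infty$ and measurable $f:\mathbb{R}^d\to\mathbb{C}$, $\|f\|^p_{\mathcal{L}^p(\mathbb{R}^d)}=\lim_{L\to\infty}\frac1{(2L)^d}\int_{[-L,L]^d}|f(x)|^pdx$; in particular $\|F\|^4_{\mathcal{L}^4_{t,x}(\mathbb{R}\times\mathbb{R})}=\lim_{L\to\infty}\frac{1}{(2L)^2}\int_{[-L,L]^2}|F(t,x)|^4dx\,dt$. $\mathcal{B}_2(\mathbb{R})$ (Besicovitch-almost periodic functions) is the closure of the trigonometric polynomials (finite sums $\sum a_\lambda e^{i\lambda x}$, $\lambda\in\mathbb{R}$) under $\|\cdot\|_{\mathcal{L}^2_x}$ (functions at distance $0$ are identified). For $f\in\mathcal{B}_2(\mathbb{R})$, $\hat f(\lambda)=\lim_{L\to\infty}\frac1{2L}\int_{-L}^Lf(x)e^{-i\lambda x}dx$ is nonzero for at most countably many $\lambda$ and $f=\sum_\lambda\hat f(\lambda)e^{i\lambda x}$ in $\mathcal{L}^2_x$.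 Propagators: $e^{it\partial_x^2}f=\sum_\lambda\hat f(\lambda)e^{i(\lambda x-t\lambda^2)}$, $e^{t\partial_x^3}f=\sum_\lambda\hat f(\lambda)e^{i(\lambda x-t\lambda^3)}$. *)

theory Defs
  imports "HOL-Analysis.Analysis"
begin

section \<open>Besicovitch norms\<close>

text \<open>
  The average of \<open>|f|^p\<close> over the cube \<open>[-L,L]^d\<close>.  It is taken in \<open>ennreal\<close> so that a function
  that is not locally \<open>p\<close>-integrable has infinite (and not, as for the Bochner integral, zero) mean.
\<close>
definition besicovitch_mean :: "real \<Rightarrow> ('a::euclidean_space \<Rightarrow> complex) \<Rightarrow> real \<Rightarrow> ennreal" where
  "besicovitch_mean p f L =
     (\<integral>\<^sup>+ x \<in> cbox (- (L *\<^sub>R One)) (L *\<^sub>R One). ennreal (norm (f x) powr p) \<partial>lebesgue)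
       / ennreal ((2 * L) ^ DIM('a))"

text \<open>The limit defining the norm exists and is finite.\<close>
definition has_besicovitch_norm :: "real \<Rightarrow> ('a::euclidean_space \<Rightarrow> complex) \<Rightarrow> bool" where
  "has_besicovitch_norm p f \<longleftrightarrow>
     f \<in> borel_measurable lebesgue \<and>
     (\<exists>c<\<infinity>. (besicovitch_mean p f \<longlongrightarrow> c) at_top)"

text \<open>Only meaningful together with \<open>has_besicovitch_norm p f\<close>.\<close>
definition besicovitch_norm :: "real \<Rightarrow> ('a::euclidean_space \<Rightarrow> complex) \<Rightarrow> real" where
  "besicovitch_norm p f = enn2real (Lim at_top (besicovitch_mean p f)) powr (1 / p)"

section \<open>Besicovitch almost periodic functions\<close>

definition trig_polynomials :: "(real \<Rightarrow> complex) set" where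
  "trig_polynomials = {P. \<exists>\<Lambda> a. finite \<Lambda> \<and> P = (\<lambda>x. \<Sum>\<xi>\<in>\<Lambda>. a \<xi> * cis (\<xi> * x))}"

text \<open>
  The elements are functions rather than classes modulo \<open>\<L>^2\<close>-null functions; the set is closed
  under this identification, and norm and Fourier coefficients do not depend on the representative.
\<close>
definition besicovitch_ap2 :: "(real \<Rightarrow> complex) set" where
  "besicovitch_ap2 =
     {f \<in> borel_measurable lebesgue.
        \<forall>\<epsilon>>0. \<exists>P\<in>trig_polynomials.
          has_besicovitch_norm 2 (\<lambda>x. f x - P x) \<and> besicovitch_norm 2 (\<lambda>x. f x - P x) < \<epsilon>}"

definition bohr_fourier :: "(real \<Rightarrow> complex) \<Rightarrow> real \<Rightarrow> complex" where
  "bohr_fourier f \<xi> =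
     Lim at_top (\<lambda>L. complex_of_real (1 / (2 * L)) *
       (LINT x:{-L..L}|lebesgue. f x * cis (- (\<xi> * x))))"

section \<open>Series in Besicovitch spaces and propagators\<close>

text \<open>
  \<open>F\<close> is the unordered sum of the functions \<open>g \<xi>\<close>, \<open>\<xi> \<in> \<real>\<close>, with convergence in \<open>\<L>^p\<close>.
  Such an \<open>F\<close> is unique up to functions of \<open>\<L>^p\<close>-norm zero.
\<close>
definition has_besicovitch_sum ::
    "real \<Rightarrow> (real \<Rightarrow> 'a::euclidean_space \<Rightarrow> complex) \<Rightarrow> ('a \<Rightarrow> complex) \<Rightarrow> bool" where
  "has_besicovitch_sum p g F \<longleftrightarrow>
     (\<forall>\<epsilon>>0. \<forall>\<^sub>F \<Lambda> in finite_subsets_at_top UNIV.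
        has_besicovitch_norm p (\<lambda>y. F y - (\<Sum>\<xi>\<in>\<Lambda>. g \<xi> y)) \<and>
        besicovitch_norm p (\<lambda>y. F y - (\<Sum>\<xi>\<in>\<Lambda>. g \<xi> y)) < \<epsilon>)"

text \<open>
  The terms of the series for the propagator with dispersion relation \<open>\<phi>\<close>: on \<open>exp (i \<xi> x)\<close>,
  \<open>exp (i t \<partial>\<^sub>x^2)\<close> acts as multiplication by \<open>exp (- i t \<xi>^2)\<close> and \<open>exp (t \<partial>\<^sub>x^3)\<close> as multiplication
  by \<open>exp (- i t \<xi>^3)\<close>.
\<close>
definition propagator_term ::
    "(real \<Rightarrow> real) \<Rightarrow> (real \<Rightarrow> complex) \<Rightarrow> real \<Rightarrow> real \<times> real \<Rightarrow> complex" where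
  "propagator_term \<phi> u \<xi> = (\<lambda>(t, x). bohr_fourier u \<xi> * cis (\<xi> * x - t * \<phi> \<xi>))"

text \<open>\<open>v\<close> is the propagator at the fixed time \<open>t\<close> applied to \<open>u\<close>, as an element of \<open>\<L>^2\<^sub>x\<close>.\<close>
definition is_propagator_at ::
    "(real \<Rightarrow> real) \<Rightarrow> (real \<Rightarrow> complex) \<Rightarrow> real \<Rightarrow> (real \<Rightarrow> complex) \<Rightarrow> bool" where
  "is_propagator_at \<phi> u t v \<longleftrightarrow> has_besicovitch_sum 2 (\<lambda>\<xi> x. propagator_term \<phi> u \<xi> (t, x)) v"

text \<open>
  \<open>F\<close> is the space-time function given by the propagator series, as an element of
  \<open>\<L>^4\<^bsub>t,x\<^esub>\<close>.  Convergence in \<open>\<L>^2\<close> would not determine the \<open>\<L>^4\<close>-norm of \<open>F\<close>: sparse, tall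
  bumps have vanishing \<open>\<L>^2\<close>-norm and infinite \<open>\<L>^4\<close>-norm.
\<close>
definition is_spacetime_propagator ::
    "(real \<Rightarrow> real) \<Rightarrow> (real \<Rightarrow> complex) \<Rightarrow> (real \<times> real \<Rightarrow> complex) \<Rightarrow> bool" where
  "is_spacetime_propagator \<phi> u F \<longleftrightarrow> has_besicovitch_sum 4 (propagator_term \<phi> u) F"

end

(*
  For a trigonometric polynomial the fourth power mean of the propagated sum is a sum of
  b_i b_j cnj (b_k b_l) over the quadruples with i + j = k + l and phi i + phi j = phi k + phi l.
  For phi = xi^2 and phi = xi^3 such a quadruple satisfies {i, j} = {k, l}, or, for the cube only,
  i + j = k + l = 0; each of the three families contributes at most (sum |b|^2)^2, so the estimate
  holds with K = 3^(1/4).  By Bessel's inequality it passes to limits in L^4.  The limit itself is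
  the Besicovitch-Marcinkiewicz patchwork: F equals the n-th partial sum on the shell
  R_n < max |t| |x| <= R_(n+1) with R_n growing fast.  Every time slice of F is then a patchwork
  as well, up to a bounded set, and it works for all t at once because the means of the slices
  converge at a rate depending only on the moduli of the coefficients.
*)

theory Submission
  imports Defs
begin

section \<open>Besicovitch norms as limits of seminorms\<close>

text \<open>Functions whose means converge are not closed under addition, so there is no normed
  space to work in. Existence of every norm is therefore drawn from two sources: the mean over one
  fixed cube satisfies Minkowski's inequality, and finite exponential sums have means that can be
  computed. Everything else is a limit of such sums. The second obstacle is that the propagator has
  to be an actual function, while square-summable coefficients give no pointwise convergence of the
  series. The way out is that the norm ignores bounded sets, so the partial sum in use may change
  with the distance from the origin. The growth of the radii serves two ends: beyond R_n the means
  of all differences of the n-th and an earlier partial sum have settled near their limits, and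
  doubling turns the volumes of the earlier cubes into a geometric series. The exponent 4 matters
  because the fourth power of a modulus is the squared modulus of a square, and the square of an
  exponential sum is again an exponential sum, indexed by pairs.\<close>

abbreviation cube :: "real \<Rightarrow> 'a::euclidean_space set" where
  "cube L \<equiv> cbox (- (L *\<^sub>R One)) (L *\<^sub>R One)"

lemma besicovitch_mean_eq:
  "besicovitch_mean p (f :: 'a::euclidean_space \<Rightarrow> complex) L =
     (\<integral>\<^sup>+ x. ennreal (norm (f x) powr p) \<partial>lebesgue_on (cube L)) / ennreal ((2 * L) ^ DIM('a))"
  unfolding besicovitch_mean_def by (simp add: nn_integral_restrict_space)

lemma ennreal_divide_le_iff:
  assumes "0 < b"
  shows "x / ennreal b \<le> c \<longleftrightarrow> x \<le> c * ennreal b"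
proof
  assume "x / ennreal b \<le> c"
  then have "x / ennreal b * ennreal b \<le> c * ennreal b" by (rule mult_right_mono) simp
  moreover have "x / ennreal b * ennreal b = x"
    using assms by (simp add: ennreal_divide_times ennreal_mult_divide_eq)
  ultimately show "x \<le> c * ennreal b" by simp
next
  assume "x \<le> c * ennreal b"
  then show "x / ennreal b \<le> c" using assms
    by (intro divide_le_posI_ennreal) (auto simp: mult.commute)
qed

lemma besicovitch_mean_le_iff:
  fixes f :: "'a::euclidean_space \<Rightarrow> complex"
  assumes "L > 0"
  shows "besicovitch_mean p f L \<le> c \<longleftrightarrow>
     (\<integral>\<^sup>+ x. ennreal (norm (f x) powr p) \<partial>lebesgue_on (cube L)) \<le> c * ennreal ((2 * L) ^ DIM('a))"
  unfolding besicovitch_mean_eq using assms by (intro ennreal_divide_le_iff) simp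

section \<open>Minkowski's inequality for the mean over one cube\<close>

lemma besicovitch_mean_lincomb:
  fixes f g h :: "'a::euclidean_space \<Rightarrow> complex"
  assumes [measurable]: "f \<in> borel_measurable lebesgue" "g \<in> borel_measurable lebesgue"
    and "\<alpha> \<ge> 0" "\<beta> \<ge> 0" "L > 0"
    and le: "\<And>x. norm (h x) powr p \<le> \<alpha> * norm (f x) powr p + \<beta> * norm (g x) powr p"
  shows "besicovitch_mean p h L \<le> ennreal \<alpha> * besicovitch_mean p f L + ennreal \<beta> * besicovitch_mean p g L"
proof -
  let ?M = "lebesgue_on (cube L :: 'a set)"
  have [measurable]: "f \<in> borel_measurable ?M" "g \<in> borel_measurable ?M"
    using assms(1,2) by (auto intro: measurable_restrict_space1)
  have "(\<integral>\<^sup>+ x. ennreal (norm (h x) powr p) \<partial>?M) \<le>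
      (\<integral>\<^sup>+ x. ennreal \<alpha> * ennreal (norm (f x) powr p) + ennreal \<beta> * ennreal (norm (g x) powr p) \<partial>?M)"
    using assms(3,4) le
    by (intro nn_integral_mono) (simp flip: ennreal_mult' ennreal_plus)
  also have "\<dots> = ennreal \<alpha> * (\<integral>\<^sup>+ x. ennreal (norm (f x) powr p) \<partial>?M)
      + ennreal \<beta> * (\<integral>\<^sup>+ x. ennreal (norm (g x) powr p) \<partial>?M)"
    by (simp add: nn_integral_add nn_integral_cmult)
  finally show ?thesis
    unfolding besicovitch_mean_eq
    by (simp add: divide_right_mono_ennreal ennreal_times_divide flip: add_divide_distrib_ennreal)
qed

text \<open>Convexity of the p-th power, applied to (x + y) / (a + b) as the average of x / a and y
  / b with weights a / (a + b) and b / (a + b). The coefficients are arranged so that inserting a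
  and b for x and y gives exactly (a + b)^p.\<close>

lemma powr_add_le_weighted:
  fixes x y a b p :: real
  assumes "p \<ge> 1" "x \<ge> 0" "y \<ge> 0" "a > 0" "b > 0"
  shows "(x + y) powr p \<le>
    (a + b) powr p * (a / (a + b) / a powr p) * x powr p + (a + b) powr p * (b / (a + b) / b powr p) * y powr p"
proof -
  define t where "t = a / (a + b)"
  have t: "0 < t" "t < 1" "b / (a + b) = 1 - t"
    using assms by (auto simp: t_def field_simps)
  \<comment> \<open>Convexity is invoked for positive arguments only; if u or v vanishes, the claim
    comes down to this inequality for a weight.\<close>
  have small: "s powr p \<le> s" if "0 < s" "s < 1" for s :: real
    using powr_mono'[of 1 p s] that assms(1) by simp
  have conv: "(t * u + (1 - t) * v) powr p \<le> t * u powr p + (1 - t) * v powr p"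
    if uv: "u \<ge> 0" "v \<ge> 0" for u v
  proof -
    consider "u = 0" | "v = 0" | "u > 0" "v > 0" using uv by linarith
    then show ?thesis
    proof cases
      case 1
      then show ?thesis using small[of "1 - t"] t uv assms(1)
        by (auto simp: powr_mult intro!: mult_right_mono)
    next
      case 2
      then show ?thesis using small[of "t"] t uv assms(1)
        by (auto simp: powr_mult intro!: mult_right_mono)
    next
      case 3
      then show ?thesis
        using convex_onD[OF powr_convex[OF assms(1)], of "1 - t" u v] t by simp
    qed
  qed
  have "x + y = (a + b) * (t * (x / a) + (1 - t) * (y / b))"
    using assms unfolding t(3)[symmetric] by (simp add: t_def distrib_left)
  then have "(x + y) powr p = (a + b) powr p * (t * (x / a) + (1 - t) * (y / b)) powr p"
    using assms t by (simp add: powr_mult)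
  also have "\<dots> \<le> (a + b) powr p * (t * (x / a) powr p + (1 - t) * (y / b) powr p)"
    using assms by (intro mult_left_mono conv) auto
  finally show ?thesis
    using assms unfolding t(3) t_def[symmetric] by (simp add: powr_divide algebra_simps)
qed

text \<open>The weights are adapted to the bounds a and b, so integrating the pointwise inequality
  suffices and Hoelder's inequality is avoided. Dividing by a and b is why both are strictly
  positive.\<close>

lemma besicovitch_mean_triangle:
  fixes f g :: "'a::euclidean_space \<Rightarrow> complex"
  assumes "f \<in> borel_measurable lebesgue" "g \<in> borel_measurable lebesgue"
    and "p \<ge> 1" "a > 0" "b > 0" "L > 0"
    and "besicovitch_mean p f L \<le> ennreal (a powr p)" "besicovitch_mean p g L \<le> ennreal (b powr p)"
  shows "besicovitch_mean p (\<lambda>x. f x + g x) L \<le> ennreal ((a + b) powr p)"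
proof -
  let ?\<alpha> = "(a + b) powr p * (a / (a + b) / a powr p)"
  let ?\<beta> = "(a + b) powr p * (b / (a + b) / b powr p)"
  have "besicovitch_mean p (\<lambda>x. f x + g x) L \<le>
      ennreal ?\<alpha> * besicovitch_mean p f L + ennreal ?\<beta> * besicovitch_mean p g L"
  proof (rule besicovitch_mean_lincomb)
    fix x
    have "norm (f x + g x) powr p \<le> (norm (f x) + norm (g x)) powr p"
      using assms(3) by (intro powr_mono2 norm_triangle_ineq) auto
    also have "\<dots> \<le> ?\<alpha> * norm (f x) powr p + ?\<beta> * norm (g x) powr p"
      using assms by (intro powr_add_le_weighted) auto
    finally show "norm (f x + g x) powr p \<le> \<dots>" .
  qed (use assms in auto)
  also have "\<dots> \<le> ennreal ?\<alpha> * ennreal (a powr p) + ennreal ?\<beta> * ennreal (b powr p)"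
    using assms by (intro add_mono mult_left_mono) auto
  also have "\<dots> = ennreal (?\<alpha> * a powr p + ?\<beta> * b powr p)"
    using assms by (simp flip: ennreal_mult' ennreal_plus)
  also have "?\<alpha> * a powr p + ?\<beta> * b powr p = (a + b) powr p * (a / (a + b) + b / (a + b))"
    using assms by (simp add: distrib_left)
  also have "a / (a + b) + b / (a + b) = 1"
    using assms by (simp flip: add_divide_distrib)
  finally show ?thesis using assms by simp
qed

text \<open>Since \<open>enn2real\<close> sends infinity to 0, this value carries information only
  together with finiteness of the mean, which the lemmas below state alongside it.\<close>

definition mean_norm :: "real \<Rightarrow> ('a::euclidean_space \<Rightarrow> complex) \<Rightarrow> real \<Rightarrow> real" where
  "mean_norm p f L = enn2real (besicovitch_mean p f L) powr (1 / p)"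

lemma mean_norm_nonneg: "mean_norm p f L \<ge> 0"
  by (simp add: mean_norm_def)

lemma besicovitch_mean_eq_mean_norm:
  assumes "p \<ge> 1" "besicovitch_mean p f L < \<infinity>"
  shows "besicovitch_mean p f L = ennreal (mean_norm p f L powr p)"
  using assms by (simp add: mean_norm_def powr_powr)

text \<open>Bridge between the two scales: a single \<open>ennreal\<close> inequality encodes both
  finiteness of the mean and a bound on its p-th root.\<close>

lemma besicovitch_mean_le_powr_iff:
  assumes "p \<ge> 1" "a \<ge> 0"
  shows "besicovitch_mean p f L \<le> ennreal (a powr p) \<longleftrightarrow>
    besicovitch_mean p f L < \<infinity> \<and> mean_norm p f L \<le> a"
proof (cases "besicovitch_mean p f L < \<infinity>")
  case True
  have "ennreal (mean_norm p f L powr p) \<le> ennreal (a powr p) \<longleftrightarrow> mean_norm p f L \<le> a"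
    using assms mean_norm_nonneg[of p f L] powr_less_mono2[of p a "mean_norm p f L"]
    by (auto intro: powr_mono2) (meson not_le order.strict_trans2 zero_less_one)
  then show ?thesis
    using besicovitch_mean_eq_mean_norm[OF assms(1) True] True by simp
next
  case False
  then show ?thesis
    by (metis ennreal_less_top infinity_ennreal_def order_le_less_trans)
qed

lemma mean_norm_triangle:
  fixes f g :: "'a::euclidean_space \<Rightarrow> complex"
  assumes "f \<in> borel_measurable lebesgue" "g \<in> borel_measurable lebesgue" "p \<ge> 1" "L > 0"
    and "besicovitch_mean p f L < \<infinity>" "besicovitch_mean p g L < \<infinity>"
  shows "besicovitch_mean p (\<lambda>x. f x + g x) L < \<infinity>"
    and "mean_norm p (\<lambda>x. f x + g x) L \<le> mean_norm p f L + mean_norm p g L"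
proof -
  \<comment> \<open>The slack makes both bounds strictly positive, also when a mean vanishes, as
    \<open>besicovitch_mean_triangle\<close> demands.\<close>
  have *: "besicovitch_mean p (\<lambda>x. f x + g x) L < \<infinity> \<and>
    mean_norm p (\<lambda>x. f x + g x) L \<le> (mean_norm p f L + \<epsilon> / 2) + (mean_norm p g L + \<epsilon> / 2)"
    if "\<epsilon> > 0" for \<epsilon>
  proof -
    have "besicovitch_mean p (\<lambda>x. f x + g x) L \<le>
        ennreal (((mean_norm p f L + \<epsilon> / 2) + (mean_norm p g L + \<epsilon> / 2)) powr p)"
      using assms that
      by (intro besicovitch_mean_triangle)
         (auto simp: besicovitch_mean_le_powr_iff mean_norm_nonneg add_nonneg_pos)
    then show ?thesis
      using assms(3) that by (subst (asm) besicovitch_mean_le_powr_iff) (auto simp: mean_norm_nonneg)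
  qed
  show "besicovitch_mean p (\<lambda>x. f x + g x) L < \<infinity>" using *[of 1] by simp
  show "mean_norm p (\<lambda>x. f x + g x) L \<le> mean_norm p f L + mean_norm p g L"
    by (rule field_le_epsilon) (use * in force)
qed

lemma besicovitch_mean_minus_commute:
  "besicovitch_mean p (\<lambda>x. f x - g x) = besicovitch_mean p (\<lambda>x. g x - f x)"
  by (simp add: fun_eq_iff besicovitch_mean_def norm_minus_commute)

lemma mean_norm_minus_commute:
  "mean_norm p (\<lambda>x. f x - g x) = mean_norm p (\<lambda>x. g x - f x)"
  by (simp add: fun_eq_iff mean_norm_def besicovitch_mean_minus_commute[of p f g])

lemma mean_norm_approx:
  fixes f g :: "'a::euclidean_space \<Rightarrow> complex"
  assumes meas: "f \<in> borel_measurable lebesgue" "g \<in> borel_measurable lebesgue"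
    and "p \<ge> 1" "L > 0"
    and g: "besicovitch_mean p g L < \<infinity>" and fg: "besicovitch_mean p (\<lambda>x. f x - g x) L < \<infinity>"
  shows "besicovitch_mean p f L < \<infinity>"
    and "\<bar>mean_norm p f L - mean_norm p g L\<bar> \<le> mean_norm p (\<lambda>x. f x - g x) L"
proof -
  have m: "(\<lambda>x. f x - g x) \<in> borel_measurable lebesgue" "(\<lambda>x. g x - f x) \<in> borel_measurable lebesgue"
    using meas by simp_all
  note 1 = mean_norm_triangle[OF meas(2) m(1) assms(3,4) g fg]
  show f: "besicovitch_mean p f L < \<infinity>" using 1(1) by simp
  have fg': "besicovitch_mean p (\<lambda>x. g x - f x) L < \<infinity>"
    using fg by (simp add: besicovitch_mean_minus_commute[of p g f])
  note 2 = mean_norm_triangle(2)[OF meas(1) m(2) assms(3,4) f fg']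
  show "\<bar>mean_norm p f L - mean_norm p g L\<bar> \<le> mean_norm p (\<lambda>x. f x - g x) L"
    using 1(2) 2 mean_norm_minus_commute[of p f g] by simp
qed

section \<open>Existence and stability of the limiting norm\<close>

text \<open>Real-valued form of \<open>has_besicovitch_norm\<close> with the value attached; for p
  at least 1 the two lemmas that follow translate in both directions. Taking the root before the
  limit makes the triangle inequality directly applicable.\<close>

definition besicovitch_norm_is :: "real \<Rightarrow> ('a::euclidean_space \<Rightarrow> complex) \<Rightarrow> real \<Rightarrow> bool" where
  "besicovitch_norm_is p f c \<longleftrightarrow> f \<in> borel_measurable lebesgue \<and>
     (\<forall>\<^sub>F L in at_top. besicovitch_mean p f L < \<infinity>) \<and> (mean_norm p f \<longlongrightarrow> c) at_top"

lemma besicovitch_norm_isD: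
  fixes f :: "'a::euclidean_space \<Rightarrow> complex"
  assumes "p \<ge> 1" "besicovitch_norm_is p f c"
  shows "has_besicovitch_norm p f" "besicovitch_norm p f = c" "c \<ge> 0"
proof -
  have lim: "(mean_norm p f \<longlongrightarrow> c) at_top" and ev: "\<forall>\<^sub>F L in at_top. besicovitch_mean p f L < \<infinity>"
    using assms by (auto simp: besicovitch_norm_is_def)
  show c: "c \<ge> 0"
    by (rule tendsto_lowerbound[OF lim]) (auto simp: mean_norm_nonneg)
  have "((\<lambda>L. ennreal (mean_norm p f L powr p)) \<longlongrightarrow> ennreal (c powr p)) at_top"
    using assms(1) by (intro tendsto_ennrealI tendsto_powr'[OF lim]) (auto simp: mean_norm_nonneg)
  then have m: "(besicovitch_mean p f \<longlongrightarrow> ennreal (c powr p)) at_top"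
    by (rule Lim_transform_eventually)
       (use ev in \<open>auto elim!: eventually_mono simp: besicovitch_mean_eq_mean_norm[OF assms(1)]\<close>)
  then show "has_besicovitch_norm p f"
    using assms(2) unfolding has_besicovitch_norm_def besicovitch_norm_is_def by force
  show "besicovitch_norm p f = c"
    using tendsto_Lim[OF _ m] assms(1) c by (simp add: besicovitch_norm_def powr_powr)
qed

lemma has_besicovitch_normD:
  fixes f :: "'a::euclidean_space \<Rightarrow> complex"
  assumes "p \<ge> 1" "has_besicovitch_norm p f"
  shows "besicovitch_norm_is p f (besicovitch_norm p f)"
proof -
  obtain c where c: "c < \<infinity>" "(besicovitch_mean p f \<longlongrightarrow> c) at_top"
    using assms(2) unfolding has_besicovitch_norm_def by blast
  have "\<forall>\<^sub>F L in at_top. besicovitch_mean p f L < \<infinity>"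
    using order_tendstoD(2)[OF c(2,1)] .
  moreover have "(mean_norm p f \<longlongrightarrow> enn2real c powr (1 / p)) at_top"
    unfolding mean_norm_def using assms(1) c
    by (intro tendsto_powr' tendsto_enn2real tendsto_const) auto
  moreover have "enn2real c powr (1 / p) = besicovitch_norm p f"
    using tendsto_Lim[OF _ c(2)] by (simp add: besicovitch_norm_def)
  ultimately show ?thesis
    using assms(2) unfolding besicovitch_norm_is_def has_besicovitch_norm_def by simp
qed

lemma besicovitch_norm_is_close:
  fixes f g :: "'a::euclidean_space \<Rightarrow> complex"
  assumes p: "p \<ge> 1" and f: "besicovitch_norm_is p f c" and g: "besicovitch_norm_is p g d"
    and "\<epsilon> \<ge> 0" and ev: "\<forall>\<^sub>F L in at_top. besicovitch_mean p (\<lambda>x. f x - g x) L \<le> ennreal (\<epsilon> powr p)"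
  shows "\<bar>c - d\<bar> \<le> \<epsilon>"
proof (rule tendsto_upperbound)
  show "((\<lambda>L. \<bar>mean_norm p f L - mean_norm p g L\<bar>) \<longlongrightarrow> \<bar>c - d\<bar>) at_top"
    using f g unfolding besicovitch_norm_is_def by (auto intro!: tendsto_intros)
  have "\<forall>\<^sub>F L in at_top. besicovitch_mean p g L < \<infinity>"
    using g by (auto simp: besicovitch_norm_is_def)
  with ev eventually_gt_at_top[of 0]
  show "\<forall>\<^sub>F L in at_top. \<bar>mean_norm p f L - mean_norm p g L\<bar> \<le> \<epsilon>"
  proof eventually_elim
    case (elim L)
    then show ?case
      using mean_norm_approx(2)[of f g p L] f g p
      unfolding besicovitch_norm_is_def besicovitch_mean_le_powr_iff[OF p assms(4)] by force
  qed
qed auto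

text \<open>The source of existence for all norms of non-explicit functions. For large L the value
  \<open>mean_norm p f L\<close> stays close to \<open>mean_norm p g L\<close>, hence to a fixed
  number; as this works for every tolerance, the values form a Cauchy filter.\<close>

lemma besicovitch_norm_is_limit:
  fixes f :: "'a::euclidean_space \<Rightarrow> complex"
  assumes p: "p \<ge> 1" and f: "f \<in> borel_measurable lebesgue"
    and approx: "\<And>\<epsilon>. \<epsilon> > 0 \<Longrightarrow> \<exists>g c. besicovitch_norm_is p g c \<and>
      (\<forall>\<^sub>F L in at_top. besicovitch_mean p (\<lambda>x. f x - g x) L \<le> ennreal (\<epsilon> powr p))"
  obtains c where "besicovitch_norm_is p f c"
proof -
  have *: "\<exists>d. (\<forall>\<^sub>F L in at_top. besicovitch_mean p f L < \<infinity>) \<and>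
      (\<forall>\<^sub>F L in at_top. \<bar>mean_norm p f L - d\<bar> \<le> \<epsilon>)" if pos: "\<epsilon> > 0" for \<epsilon>
  proof -
    obtain g d where g: "besicovitch_norm_is p g d"
      and ev: "\<forall>\<^sub>F L in at_top. besicovitch_mean p (\<lambda>x. f x - g x) L \<le> ennreal ((\<epsilon> / 2) powr p)"
      using approx[of "\<epsilon> / 2"] pos by auto
    have lim: "(mean_norm p g \<longlongrightarrow> d) at_top" and fin: "\<forall>\<^sub>F L in at_top. besicovitch_mean p g L < \<infinity>"
      using g by (auto simp: besicovitch_norm_is_def)
    have "\<forall>\<^sub>F L in at_top. \<bar>mean_norm p g L - d\<bar> < \<epsilon> / 2"
      using tendstoD[OF lim, of "\<epsilon> / 2"] pos by (simp add: dist_real_def)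
    with ev fin eventually_gt_at_top[of 0]
    have "\<forall>\<^sub>F L in at_top. besicovitch_mean p f L < \<infinity> \<and> \<bar>mean_norm p f L - d\<bar> \<le> \<epsilon>"
    proof eventually_elim
      case (elim L)
      have le: "besicovitch_mean p (\<lambda>x. f x - g x) L < \<infinity>" "mean_norm p (\<lambda>x. f x - g x) L \<le> \<epsilon> / 2"
        using elim(1) pos by (auto simp: besicovitch_mean_le_powr_iff[OF p])
      have gm: "g \<in> borel_measurable lebesgue"
        using g by (simp add: besicovitch_norm_is_def)
      note fin = mean_norm_approx[OF f gm p elim(3) elim(2) le(1)]
      have "\<bar>mean_norm p f L - d\<bar> \<le> \<epsilon>"
        using fin(2) le(2) elim(4) by linarith
      with fin(1) show ?case by simp
    qed
    then show ?thesis by (auto simp: eventually_conj_iff)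
  qed
  have "\<exists>c. (mean_norm p f \<longlongrightarrow> c) at_top"
  proof -
    have "cauchy_filter (filtermap (mean_norm p f) at_top)"
      unfolding cauchy_filter_metric_filtermap
    proof (intro allI impI)
      fix e :: real assume "e > 0"
      then obtain d where d: "\<forall>\<^sub>F L in at_top. \<bar>mean_norm p f L - d\<bar> \<le> e / 3"
        using *[of "e / 3"] by auto
      \<comment> \<open>Two values within e / 3 of the same d are at distance at most 2 e /
        3.\<close>
      show "\<exists>P. eventually P at_top \<and> (\<forall>x y. P x \<and> P y \<longrightarrow> dist (mean_norm p f x) (mean_norm p f y) < e)"
      proof (intro exI conjI allI impI)
        fix x y assume "\<bar>mean_norm p f x - d\<bar> \<le> e / 3 \<and> \<bar>mean_norm p f y - d\<bar> \<le> e / 3"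
        then show "dist (mean_norm p f x) (mean_norm p f y) < e"
          using \<open>e > 0\<close> unfolding dist_real_def by linarith
      qed (rule d)
    qed
    then show ?thesis
      using complete_uniform[where S="UNIV::real set"] complete_UNIV
      by (auto simp: filterlim_def trivial_limit_at_top_linorder filtermap_bot_iff)
  qed
  then show thesis
    using that f *[of 1] unfolding besicovitch_norm_is_def by auto
qed

section \<open>Means of exponential sums\<close>

text \<open>Average of the function itself, not of a power of its modulus, so that oscillation can
  cancel. The gauge integral is adequate because it is applied to continuous functions.\<close>

definition mean_value :: "real \<Rightarrow> ('a::euclidean_space \<Rightarrow> 'b::euclidean_space) \<Rightarrow> 'b" where
  "mean_value L f = integral (cube L) f /\<^sub>R (2 * L) ^ DIM('a)"

lemma integrable_on_cube:
  fixes f :: "'a::euclidean_space \<Rightarrow> 'b::euclidean_space"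
  assumes "continuous_on UNIV f"
  shows "f integrable_on cube L"
  using assms by (intro integrable_continuous) (auto intro: continuous_on_subset)

lemma mean_value_sum:
  fixes E :: "'i \<Rightarrow> 'a::euclidean_space \<Rightarrow> complex"
  assumes "finite J" "\<And>j. j \<in> J \<Longrightarrow> continuous_on UNIV (E j)"
  shows "mean_value L (\<lambda>y. \<Sum>j\<in>J. a j * E j y) = (\<Sum>j\<in>J. a j * mean_value L (E j))"
proof -
  have "integral (cube L) (\<lambda>y. \<Sum>j\<in>J. a j * E j y) = (\<Sum>j\<in>J. a j * integral (cube L) (E j))"
    using assms by (subst integral_sum) (auto intro!: integrable_on_cube continuous_intros)
  then show ?thesis
    by (simp add: mean_value_def scaleR_sum_right scaleR_conv_of_real sum_distrib_left mult_ac)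
qed

lemma mean_value_Re:
  fixes f :: "'a::euclidean_space \<Rightarrow> complex"
  assumes "continuous_on UNIV f"
  shows "mean_value L (\<lambda>y. Re (f y)) = Re (mean_value L f)"
  using integral_linear[OF integrable_on_cube[OF assms] bounded_linear_Re, of L]
  by (simp add: mean_value_def o_def)

lemma besicovitch_mean_continuous:
  fixes f :: "'a::euclidean_space \<Rightarrow> complex"
  assumes f: "continuous_on UNIV f" and "p > 0" "L > 0"
  shows "besicovitch_mean p f L = ennreal (mean_value L (\<lambda>y. norm (f y) powr p))"
    and "mean_value L (\<lambda>y. norm (f y) powr p) \<ge> 0"
proof -
  let ?g = "\<lambda>y. norm (f y) powr p"
  have g: "continuous_on UNIV ?g"
    using f \<open>p > 0\<close> by (intro continuous_on_powr' continuous_intros) auto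
  have "integral\<^sup>N lborel (\<lambda>x. ennreal (?g x) * indicator (cube L) x) = ennreal (integral (cube L) ?g)"
    using integrable_on_cube[OF g, of L]
    by (intro nn_integral_has_integral_lebesgue') (auto simp: integrable_integral)
  moreover have nn: "integral (cube L) ?g \<ge> 0"
    by (rule integral_nonneg[OF integrable_on_cube[OF g]]) auto
  ultimately show "besicovitch_mean p f L = ennreal (mean_value L ?g)"
    using \<open>L > 0\<close> unfolding besicovitch_mean_def mean_value_def
    by (simp add: nn_integral_completion divide_ennreal field_simps)
  show "mean_value L ?g \<ge> 0"
    using nn \<open>L > 0\<close> by (simp add: mean_value_def)
qed

lemma besicovitch_norm_is_continuous:
  fixes f :: "'a::euclidean_space \<Rightarrow> complex"
  assumes f: "continuous_on UNIV f" and "p > 0"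
    and lim: "((\<lambda>L. mean_value L (\<lambda>y. norm (f y) powr p)) \<longlongrightarrow> m) at_top"
  shows "besicovitch_norm_is p f (m powr (1 / p))"
  unfolding besicovitch_norm_is_def
proof (intro conjI)
  show "f \<in> borel_measurable lebesgue"
    using f by (intro measurable_completion) (simp add: borel_measurable_continuous_onI)
  show "\<forall>\<^sub>F L in at_top. besicovitch_mean p f L < \<infinity>"
    using eventually_gt_at_top[of 0]
    by eventually_elim (simp add: besicovitch_mean_continuous(1)[OF f \<open>p > 0\<close>])
  have "((\<lambda>L. mean_value L (\<lambda>y. norm (f y) powr p) powr (1 / p)) \<longlongrightarrow> m powr (1 / p)) at_top"
    using \<open>p > 0\<close> besicovitch_mean_continuous(2)[OF f \<open>p > 0\<close>]
    by (intro tendsto_powr' lim tendsto_const)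
       (auto intro: eventually_mono[OF eventually_gt_at_top[of 0]])
  then show "(mean_norm p f \<longlongrightarrow> m powr (1 / p)) at_top"
  proof (rule Lim_transform_eventually)
    show "\<forall>\<^sub>F L in at_top. mean_value L (\<lambda>y. norm (f y) powr p) powr (1 / p) = mean_norm p f L"
      using eventually_gt_at_top[of 0]
      by eventually_elim (simp add: mean_norm_def besicovitch_mean_continuous[OF f \<open>p > 0\<close>])
  qed
qed

text \<open>For nonzero w the antiderivative cis (w x) / (i w) is bounded by 1 / |w|, so the average
  is of order 1 / L.\<close>

lemma mean_value_exp_real:
  "((\<lambda>L. mean_value L (\<lambda>x::real. cis (w * x))) \<longlongrightarrow> (if w = 0 then 1 else 0)) at_top"
proof (cases "w = 0")
  case True
  have "mean_value L (\<lambda>x::real. cis (w * x)) = 1" if "L > 0" for L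
    using that True by (simp add: mean_value_def scaleR_conv_of_real)
  then show ?thesis
    using True by (intro tendsto_eventually) (auto intro: eventually_mono[OF eventually_gt_at_top[of 0]])
next
  case False
  have bound: "norm (mean_value L (\<lambda>x::real. cis (w * x))) \<le> 1 / (L * \<bar>w\<bar>)" if "L > 0" for L
  proof -
    have "((\<lambda>x. cis (w * x)) has_integral (cis (w * L) / (\<i> * w) - cis (w * (-L)) / (\<i> * w))) {-L..L}"
    proof (rule fundamental_theorem_of_calculus)
      fix x
      show "((\<lambda>x. cis (w * x) / (\<i> * w)) has_vector_derivative cis (w * x)) (at x within {-L..L})"
        using False unfolding has_vector_derivative_def
        by (auto intro!: derivative_eq_intros simp: fun_eq_iff scaleR_conv_of_real)
           (simp add: complex_eq_iff)
    qed (use that in auto)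
    then have "norm (integral {-L..L} (\<lambda>x. cis (w * x))) = norm (cis (w * L) / (\<i> * w) - cis (w * (-L)) / (\<i> * w))"
      by (simp add: integral_unique)
    also have "\<dots> \<le> norm (cis (w * L) / (\<i> * w)) + norm (cis (w * (-L)) / (\<i> * w))"
      by (rule norm_triangle_ineq4)
    also have "\<dots> = 2 / \<bar>w\<bar>"
      by (simp add: norm_divide norm_mult)
    finally show ?thesis
      using that by (simp add: mean_value_def field_simps)
  qed
  have "((\<lambda>L. 1 / (L * \<bar>w\<bar>)) \<longlongrightarrow> 0) at_top"
    using False by real_asymp
  then have "((\<lambda>L. mean_value L (\<lambda>x::real. cis (w * x))) \<longlongrightarrow> 0) at_top"
    by (rule Lim_null_comparison[rotated]) (auto intro: bound eventually_mono[OF eventually_gt_at_top[of 0]])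
  then show ?thesis using False by simp
qed

lemma cube_plane: "(cube L :: (real \<times> real) set) = cbox (-L, -L) (L, L)"
proof -
  have "(One :: real \<times> real) = (1, 1)"
    by (simp add: sum_Basis_prod_eq zero_prod_def)
  then show ?thesis by simp
qed

lemma mean_value_exp_plane:
  "((\<lambda>L. mean_value L (\<lambda>(t::real, x::real). cis (w * x - t * v))) \<longlongrightarrow> (if w = 0 \<and> v = 0 then 1 else 0)) at_top"
proof -
  have "mean_value L (\<lambda>(t::real, x::real). cis (w * x - t * v)) =
      mean_value L (\<lambda>t::real. cis ((-v) * t)) * mean_value L (\<lambda>x::real. cis (w * x))" for L
  proof -
    have "integral (cube L) (\<lambda>(t::real, x::real). cis (w * x - t * v)) =
        integral (cbox (-L, -L) (L, L)) (\<lambda>(t::real, x::real). cis ((-v) * t) * cis (w * x))"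
      unfolding cube_plane by (simp add: cis_mult algebra_simps)
    also have "\<dots> = integral (cbox (-L) L) (\<lambda>t. integral (cbox (-L) L) (\<lambda>x. cis ((-v) * t) * cis (w * x)))"
      by (subst integral_prod_continuous)
         (auto intro!: continuous_intros simp: case_prod_beta)
    also have "\<dots> = integral (cbox (-L) L) (\<lambda>t. cis ((-v) * t)) * integral (cbox (-L) L) (\<lambda>x. cis (w * x))"
      by simp
    finally show ?thesis
      by (simp add: mean_value_def power2_eq_square scaleR_conv_of_real)
  qed
  then show ?thesis
    using tendsto_mult[OF mean_value_exp_real[of "-v"] mean_value_exp_real[of w]]
    by (auto split: if_splits)
qed

section \<open>Parseval's identity for finite exponential sums, uniformly in the phases\<close>

text \<open>Phases and index type are left arbitrary: the lemma serves sums over frequencies and,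
  for the fourth power, sums over pairs of frequencies.\<close>

lemma norm_exp_sum_sq:
  assumes "finite J"
  shows "complex_of_real ((norm (\<Sum>j\<in>J. c j * cis (\<theta> j)))\<^sup>2) =
    (\<Sum>q\<in>J \<times> J. c (fst q) * cnj (c (snd q)) * cis (\<theta> (fst q) - \<theta> (snd q)))"
proof -
  have "complex_of_real ((norm (\<Sum>j\<in>J. c j * cis (\<theta> j)))\<^sup>2) =
      (\<Sum>j\<in>J. c j * cis (\<theta> j)) * (\<Sum>j\<in>J. cnj (c j) * cis (- \<theta> j))"
    by (simp only: complex_norm_square cnj_sum complex_cnj_mult cis_cnj)
  also have "\<dots> = (\<Sum>q\<in>J \<times> J. c (fst q) * cis (\<theta> (fst q)) * (cnj (c (snd q)) * cis (- \<theta> (snd q))))"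
    by (simp add: sum_product sum.cartesian_product case_prod_beta)
  finally show ?thesis
    by (simp add: mult_ac cis_mult)
qed

text \<open>A quantitative Parseval identity. Its point is that the error involves the coefficients
  only through their moduli, so it is the same for all time slices of a propagated sum.\<close>

lemma mean_value_norm_exp_sum_sq:
  fixes c :: "real \<Rightarrow> complex"
  assumes "finite \<Lambda>"
  shows "\<bar>mean_value L (\<lambda>x. norm (\<Sum>\<xi>\<in>\<Lambda>. c \<xi> * cis (\<xi> * x)) powr 2) - (\<Sum>\<xi>\<in>\<Lambda>. (norm (c \<xi>))\<^sup>2)\<bar> \<le>
    (\<Sum>q\<in>\<Lambda> \<times> \<Lambda>. norm (c (fst q)) * norm (c (snd q)) *
       norm (mean_value L (\<lambda>x. cis ((fst q - snd q) * x)) - of_bool (fst q = snd q)))"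
proof -
  let ?P = "\<lambda>x. \<Sum>\<xi>\<in>\<Lambda>. c \<xi> * cis (\<xi> * x)"
  let ?\<mu> = "\<lambda>q. mean_value L (\<lambda>x. cis ((fst q - snd q) * x))"
  let ?S = "\<lambda>x. \<Sum>q\<in>\<Lambda> \<times> \<Lambda>. c (fst q) * cnj (c (snd q)) * cis ((fst q - snd q) * x)"
  have sq: "norm (?P x) powr 2 = Re (?S x)" for x
  proof -
    have "complex_of_real (norm (?P x) powr 2) = ?S x"
      using norm_exp_sum_sq[OF assms, of c "\<lambda>\<xi>. \<xi> * x"] by (simp add: algebra_simps)
    then show ?thesis by (metis Re_complex_of_real)
  qed
  have "mean_value L (\<lambda>x. norm (?P x) powr 2) = Re (mean_value L ?S)"
    unfolding sq by (intro mean_value_Re continuous_intros)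
  also have "mean_value L ?S = (\<Sum>q\<in>\<Lambda> \<times> \<Lambda>. c (fst q) * cnj (c (snd q)) * ?\<mu> q)"
    using assms by (intro mean_value_sum continuous_intros) auto
  finally have mv: "mean_value L (\<lambda>x. norm (?P x) powr 2) =
      Re (\<Sum>q\<in>\<Lambda> \<times> \<Lambda>. c (fst q) * cnj (c (snd q)) * ?\<mu> q)" .
  have "(\<Sum>q\<in>\<Lambda> \<times> \<Lambda>. c (fst q) * cnj (c (snd q)) * of_bool (fst q = snd q)) =
      (\<Sum>\<xi>\<in>\<Lambda>. \<Sum>\<eta>\<in>\<Lambda>. if \<xi> = \<eta> then c \<xi> * cnj (c \<eta>) else 0)"
    by (auto simp: sum.cartesian_product intro!: sum.cong)
  also have "\<dots> = (\<Sum>\<xi>\<in>\<Lambda>. complex_of_real ((norm (c \<xi>))\<^sup>2))"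
    using assms by (simp add: sum.delta complex_norm_square del: of_real_power)
  finally have diag: "(\<Sum>\<xi>\<in>\<Lambda>. (norm (c \<xi>))\<^sup>2) =
      Re (\<Sum>q\<in>\<Lambda> \<times> \<Lambda>. c (fst q) * cnj (c (snd q)) * of_bool (fst q = snd q))"
    by simp
  have "\<bar>mean_value L (\<lambda>x. norm (?P x) powr 2) - (\<Sum>\<xi>\<in>\<Lambda>. (norm (c \<xi>))\<^sup>2)\<bar> =
      \<bar>Re (\<Sum>q\<in>\<Lambda> \<times> \<Lambda>. c (fst q) * cnj (c (snd q)) * (?\<mu> q - of_bool (fst q = snd q)))\<bar>"
    unfolding mv diag by (simp add: sum_subtractf right_diff_distrib)
  also have "\<dots> \<le> norm (\<Sum>q\<in>\<Lambda> \<times> \<Lambda>. c (fst q) * cnj (c (snd q)) * (?\<mu> q - of_bool (fst q = snd q)))"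
    by (rule abs_Re_le_cmod)
  also have "\<dots> \<le> (\<Sum>q\<in>\<Lambda> \<times> \<Lambda>. norm (c (fst q)) * norm (c (snd q)) * norm (?\<mu> q - of_bool (fst q = snd q)))"
    by (rule sum_norm_le) (simp add: norm_mult)
  finally show ?thesis .
qed

lemma exp_sum_deviation_tendsto_0:
  fixes c :: "real \<Rightarrow> complex"
  shows "((\<lambda>L. \<Sum>q\<in>\<Lambda> \<times> \<Lambda>. norm (c (fst q)) * norm (c (snd q)) *
       norm (mean_value L (\<lambda>x. cis ((fst q - snd q) * x)) - of_bool (fst q = snd q))) \<longlongrightarrow> 0) at_top"
proof (rule tendsto_null_sum)
  fix q :: "real \<times> real"
  have "((\<lambda>L. mean_value L (\<lambda>x. cis ((fst q - snd q) * x))) \<longlongrightarrow> of_bool (fst q = snd q)) at_top"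
    using mean_value_exp_real[of "fst q - snd q"] by (simp add: of_bool_def)
  then have "((\<lambda>L. norm (mean_value L (\<lambda>x. cis ((fst q - snd q) * x)) - of_bool (fst q = snd q))) \<longlongrightarrow> 0) at_top"
    by (simp add: LIM_zero_iff tendsto_norm_zero)
  then show "((\<lambda>L. norm (c (fst q)) * norm (c (snd q)) *
       norm (mean_value L (\<lambda>x. cis ((fst q - snd q) * x)) - of_bool (fst q = snd q))) \<longlongrightarrow> 0) at_top"
    by (rule tendsto_mult_right_zero)
qed

lemma besicovitch_norm_is_exp_sum:
  fixes c :: "real \<Rightarrow> complex"
  assumes "finite \<Lambda>"
  shows "besicovitch_norm_is 2 (\<lambda>x. \<Sum>\<xi>\<in>\<Lambda>. c \<xi> * cis (\<xi> * x)) (sqrt (\<Sum>\<xi>\<in>\<Lambda>. (norm (c \<xi>))\<^sup>2))"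
proof -
  let ?P = "\<lambda>x. \<Sum>\<xi>\<in>\<Lambda>. c \<xi> * cis (\<xi> * x)"
  let ?s = "\<Sum>\<xi>\<in>\<Lambda>. (norm (c \<xi>))\<^sup>2"
  have "((\<lambda>L. mean_value L (\<lambda>x. norm (?P x) powr 2) - ?s) \<longlongrightarrow> 0) at_top"
    by (rule Lim_null_comparison[OF _ exp_sum_deviation_tendsto_0[of c \<Lambda>]])
       (use mean_value_norm_exp_sum_sq[OF assms] in auto)
  then have "((\<lambda>L. mean_value L (\<lambda>x. norm (?P x) powr 2)) \<longlongrightarrow> ?s) at_top"
    by (simp add: LIM_zero_iff)
  then have "besicovitch_norm_is 2 ?P (?s powr (1 / 2))"
    by (intro besicovitch_norm_is_continuous continuous_intros) auto
  moreover have "?s powr (1 / 2) = sqrt ?s"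
    by (intro powr_half_sqrt sum_nonneg) auto
  ultimately show ?thesis by simp
qed

text \<open>The quantifier over c stands inside \<open>eventually\<close>: one threshold for L
  serves all coefficients with the given moduli, hence all times, since time evolution changes
  phases only.\<close>

lemma eventually_besicovitch_mean_exp_sum_le:
  fixes b :: "real \<Rightarrow> complex"
  assumes "finite \<Lambda>" "(\<Sum>\<xi>\<in>\<Lambda>. (norm (b \<xi>))\<^sup>2) < s"
  shows "\<forall>\<^sub>F L in at_top. \<forall>c. (\<forall>\<xi>\<in>\<Lambda>. norm (c \<xi>) = norm (b \<xi>)) \<longrightarrow>
    besicovitch_mean 2 (\<lambda>x. \<Sum>\<xi>\<in>\<Lambda>. c \<xi> * cis (\<xi> * x)) L \<le> ennreal s"
proof -
  let ?s = "\<Sum>\<xi>\<in>\<Lambda>. (norm (b \<xi>))\<^sup>2"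
  let ?D = "\<lambda>(c :: real \<Rightarrow> complex) L. \<Sum>q\<in>\<Lambda> \<times> \<Lambda>. norm (c (fst q)) * norm (c (snd q)) *
       norm (mean_value L (\<lambda>x. cis ((fst q - snd q) * x)) - of_bool (fst q = snd q))"
  have "\<forall>\<^sub>F L in at_top. ?D b L < s - ?s"
    using assms(2) by (intro order_tendstoD(2)[OF exp_sum_deviation_tendsto_0]) auto
  with eventually_gt_at_top[of 0] show ?thesis
  proof eventually_elim
    case (elim L)
    show ?case
    proof (intro allI impI)
      fix c :: "real \<Rightarrow> complex" assume c: "\<forall>\<xi>\<in>\<Lambda>. norm (c \<xi>) = norm (b \<xi>)"
      have "?D c L = ?D b L" "(\<Sum>\<xi>\<in>\<Lambda>. (norm (c \<xi>))\<^sup>2) = ?s"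
        using c by (auto intro!: sum.cong)
      with mean_value_norm_exp_sum_sq[OF assms(1), of L c] elim
      have "mean_value L (\<lambda>x. norm (\<Sum>\<xi>\<in>\<Lambda>. c \<xi> * cis (\<xi> * x)) powr 2) \<le> s"
        by (simp add: abs_le_iff)
      then show "besicovitch_mean 2 (\<lambda>x. \<Sum>\<xi>\<in>\<Lambda>. c \<xi> * cis (\<xi> * x)) L \<le> ennreal s"
        using elim(1) by (subst besicovitch_mean_continuous) (auto intro!: continuous_intros ennreal_leI)
    qed
  qed
qed

section \<open>Resonances and the fourth power mean\<close>

text \<open>A common hypothesis for both dispersion relations. In the third alternative both pairs
  have sum zero, which for an odd relation is a resonance whatever i and k are.\<close>

definition only_pair_resonances :: "(real \<Rightarrow> real) \<Rightarrow> bool" where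
  "only_pair_resonances \<phi> \<longleftrightarrow> (\<forall>i j k l. i + j = k + l \<and> \<phi> i + \<phi> j = \<phi> k + \<phi> l \<longrightarrow>
     k = i \<and> l = j \<or> k = j \<and> l = i \<or> j = - i \<and> l = - k)"

text \<open>Sum and sum of squares determine the product, so i j = k l and k is a root of (X - i) (X
  - j).\<close>

lemma only_pair_resonances_square: "only_pair_resonances (\<lambda>\<xi>. \<xi> ^ 2)"
  unfolding only_pair_resonances_def
proof (intro allI impI)
  fix i j k l :: real
  assume *: "i + j = k + l \<and> i ^ 2 + j ^ 2 = k ^ 2 + l ^ 2"
  have "(k - i) * (k - j) = 0"
    using * by algebra
  then show "k = i \<and> l = j \<or> k = j \<and> l = i \<or> j = - i \<and> l = - k"
    using * by auto
qed

text \<open>With s = i + j the sum of cubes is s^3 - 3 s i j. Hence s (i j - k l) = 0, and i j - k l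
  equals (k - i) (k - j); the factor s is the origin of the extra family.\<close>

lemma only_pair_resonances_cube: "only_pair_resonances (\<lambda>\<xi>. \<xi> ^ 3)"
  unfolding only_pair_resonances_def
proof (intro allI impI)
  fix i j k l :: real
  assume *: "i + j = k + l \<and> i ^ 3 + j ^ 3 = k ^ 3 + l ^ 3"
  have "(i + j) * ((k - i) * (k - j)) = 0"
    using * by algebra
  then show "k = i \<and> l = j \<or> k = j \<and> l = i \<or> j = - i \<and> l = - k"
    using * by auto
qed

text \<open>The three families may overlap, so their indicators are added as an upper bound. The two
  permutation families sum to the squared sum of squares exactly. The third factorizes into the
  square of the sum of b_i b_(-i), which is at most the sum of squares by the arithmetic-geometric
  mean inequality.\<close>

lemma resonant_sum_le:
  fixes b :: "real \<Rightarrow> real"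
  assumes "finite \<Lambda>" "only_pair_resonances \<phi>" and b: "\<And>\<xi>. b \<xi> \<ge> 0"
  shows "(\<Sum>q\<in>(\<Lambda> \<times> \<Lambda>) \<times> (\<Lambda> \<times> \<Lambda>). case q of ((i, j), (k, l)) \<Rightarrow>
      b i * b j * (b k * b l) * of_bool (i + j = k + l \<and> \<phi> i + \<phi> j = \<phi> k + \<phi> l)) \<le>
    3 * (\<Sum>\<xi>\<in>\<Lambda>. (b \<xi>)\<^sup>2)\<^sup>2"
proof -
  let ?s = "\<Sum>\<xi>\<in>\<Lambda>. (b \<xi>)\<^sup>2"
  let ?B = "\<lambda>i j k l. b i * b j * (b k * b l)"
  have of_bool_le: "of_bool R \<le> of_bool X + of_bool Y + (of_bool Z :: real)" if "R \<Longrightarrow> X \<or> Y \<or> Z" for R X Y Z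
    using that by auto
  let ?A = "\<Sum>i\<in>\<Lambda>. \<Sum>j\<in>\<Lambda>. b i * b j * of_bool (j = - i)"
  have "(\<Sum>q\<in>(\<Lambda> \<times> \<Lambda>) \<times> (\<Lambda> \<times> \<Lambda>). case q of ((i, j), (k, l)) \<Rightarrow>
      ?B i j k l * of_bool (i + j = k + l \<and> \<phi> i + \<phi> j = \<phi> k + \<phi> l)) =
    (\<Sum>i\<in>\<Lambda>. \<Sum>j\<in>\<Lambda>. \<Sum>k\<in>\<Lambda>. \<Sum>l\<in>\<Lambda>. ?B i j k l * of_bool (i + j = k + l \<and> \<phi> i + \<phi> j = \<phi> k + \<phi> l))"
    by (simp only: sum.cartesian_product' prod.case)
  also have "\<dots> \<le> (\<Sum>i\<in>\<Lambda>. \<Sum>j\<in>\<Lambda>. \<Sum>k\<in>\<Lambda>. \<Sum>l\<in>\<Lambda>.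
      ?B i j k l * of_bool (k = i \<and> l = j) + ?B i j k l * of_bool (k = j \<and> l = i)
      + ?B i j k l * of_bool (j = - i \<and> l = - k))"
  proof (intro sum_mono)
    fix i j k l
    have "of_bool (i + j = k + l \<and> \<phi> i + \<phi> j = \<phi> k + \<phi> l) \<le>
      of_bool (k = i \<and> l = j) + of_bool (k = j \<and> l = i) + (of_bool (j = - i \<and> l = - k) :: real)"
    proof (rule of_bool_le)
      assume "i + j = k + l \<and> \<phi> i + \<phi> j = \<phi> k + \<phi> l"
      then show "k = i \<and> l = j \<or> k = j \<and> l = i \<or> j = - i \<and> l = - k"
        by (rule assms(2)[unfolded only_pair_resonances_def, rule_format])
    qed
    then have "?B i j k l * of_bool (i + j = k + l \<and> \<phi> i + \<phi> j = \<phi> k + \<phi> l) \<le> ?B i j k l *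
      (of_bool (k = i \<and> l = j) + of_bool (k = j \<and> l = i) + of_bool (j = - i \<and> l = - k))"
      using b by (intro mult_left_mono) auto
    then show "?B i j k l * of_bool (i + j = k + l \<and> \<phi> i + \<phi> j = \<phi> k + \<phi> l) \<le>
      ?B i j k l * of_bool (k = i \<and> l = j) + ?B i j k l * of_bool (k = j \<and> l = i)
      + ?B i j k l * of_bool (j = - i \<and> l = - k)"
      by (simp only: distrib_left)
  qed
  also have "\<dots> = (\<Sum>i\<in>\<Lambda>. \<Sum>j\<in>\<Lambda>. \<Sum>k\<in>\<Lambda>. \<Sum>l\<in>\<Lambda>. ?B i j k l * of_bool (k = i \<and> l = j))
      + (\<Sum>i\<in>\<Lambda>. \<Sum>j\<in>\<Lambda>. \<Sum>k\<in>\<Lambda>. \<Sum>l\<in>\<Lambda>. ?B i j k l * of_bool (k = j \<and> l = i))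
      + (\<Sum>i\<in>\<Lambda>. \<Sum>j\<in>\<Lambda>. \<Sum>k\<in>\<Lambda>. \<Sum>l\<in>\<Lambda>. ?B i j k l * of_bool (j = - i \<and> l = - k))"
    by (simp only: sum.distrib)
  also have "(\<Sum>i\<in>\<Lambda>. \<Sum>j\<in>\<Lambda>. \<Sum>k\<in>\<Lambda>. \<Sum>l\<in>\<Lambda>. ?B i j k l * of_bool (k = i \<and> l = j)) = ?s\<^sup>2"
  proof -
    have "(\<Sum>i\<in>\<Lambda>. \<Sum>j\<in>\<Lambda>. \<Sum>k\<in>\<Lambda>. \<Sum>l\<in>\<Lambda>. ?B i j k l * of_bool (k = i \<and> l = j)) =
        (\<Sum>i\<in>\<Lambda>. \<Sum>j\<in>\<Lambda>. \<Sum>k\<in>\<Lambda>. if i = k then \<Sum>l\<in>\<Lambda>. if j = l then ?B i j k l else 0 else 0)"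
      by (auto intro!: sum.cong sum.neutral)
    also have "\<dots> = (\<Sum>i\<in>\<Lambda>. \<Sum>j\<in>\<Lambda>. (b i)\<^sup>2 * (b j)\<^sup>2)"
      using assms(1) by (intro sum.cong refl) (simp add: power2_eq_square mult_ac)
    finally show ?thesis by (simp add: sum_product power2_eq_square)
  qed
  also have "(\<Sum>i\<in>\<Lambda>. \<Sum>j\<in>\<Lambda>. \<Sum>k\<in>\<Lambda>. \<Sum>l\<in>\<Lambda>. ?B i j k l * of_bool (k = j \<and> l = i)) = ?s\<^sup>2"
  proof -
    have "(\<Sum>i\<in>\<Lambda>. \<Sum>j\<in>\<Lambda>. \<Sum>k\<in>\<Lambda>. \<Sum>l\<in>\<Lambda>. ?B i j k l * of_bool (k = j \<and> l = i)) =
        (\<Sum>i\<in>\<Lambda>. \<Sum>j\<in>\<Lambda>. \<Sum>k\<in>\<Lambda>. if j = k then \<Sum>l\<in>\<Lambda>. if i = l then ?B i j k l else 0 else 0)"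
      by (auto intro!: sum.cong sum.neutral)
    also have "\<dots> = (\<Sum>i\<in>\<Lambda>. \<Sum>j\<in>\<Lambda>. (b i)\<^sup>2 * (b j)\<^sup>2)"
      using assms(1) by (intro sum.cong refl) (simp add: power2_eq_square mult_ac)
    finally show ?thesis by (simp add: sum_product power2_eq_square)
  qed
  also have "(\<Sum>i\<in>\<Lambda>. \<Sum>j\<in>\<Lambda>. \<Sum>k\<in>\<Lambda>. \<Sum>l\<in>\<Lambda>. ?B i j k l * of_bool (j = - i \<and> l = - k)) = ?A\<^sup>2"
  proof -
    have "(\<Sum>i\<in>\<Lambda>. \<Sum>j\<in>\<Lambda>. \<Sum>k\<in>\<Lambda>. \<Sum>l\<in>\<Lambda>. ?B i j k l * of_bool (j = - i \<and> l = - k)) =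
      (\<Sum>i\<in>\<Lambda>. \<Sum>j\<in>\<Lambda>. (b i * b j * of_bool (j = - i)) * ?A)"
      by (simp add: sum_distrib_left of_bool_conj mult_ac)
    then show ?thesis by (simp add: power2_eq_square flip: sum_distrib_right)
  qed
  also have "?A\<^sup>2 \<le> ?s\<^sup>2"
  proof (rule power_mono)
    show "?A \<ge> 0" using b by (intro sum_nonneg) auto
    \<comment> \<open>A frequency has at most one negative in \<Lambda>. The second form exchanges
      the fixed and the summed index, as is required after \<open>sum.swap\<close>.\<close>
    have one: "(\<Sum>j\<in>\<Lambda>. of_bool (j = - i)) \<le> (1::real)" "(\<Sum>j\<in>\<Lambda>. of_bool (i = - j)) \<le> (1::real)" for i
    proof -
      have "(\<Sum>j\<in>\<Lambda>. of_bool (j = - i)) = (\<Sum>j\<in>\<Lambda>. if - i = j then (1::real) else 0)"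
        by (intro sum.cong) auto
      also have "\<dots> \<le> 1" using assms(1) by (simp add: sum.delta)
      finally show "(\<Sum>j\<in>\<Lambda>. of_bool (j = - i)) \<le> (1::real)" .
      moreover have "(i = - j) = (j = - i)" for j by auto
      ultimately show "(\<Sum>j\<in>\<Lambda>. of_bool (i = - j)) \<le> (1::real)" by simp
    qed
    have "?A \<le> (\<Sum>i\<in>\<Lambda>. \<Sum>j\<in>\<Lambda>. (b i)\<^sup>2 / 2 * of_bool (j = - i) + (b j)\<^sup>2 / 2 * of_bool (j = - i))"
    proof (intro sum_mono)
      fix i j
      have "b i * b j \<le> (b i)\<^sup>2 / 2 + (b j)\<^sup>2 / 2"
        using sum_squares_bound[of "b i" "b j"] by simp
      then show "b i * b j * of_bool (j = - i) \<le> (b i)\<^sup>2 / 2 * of_bool (j = - i) + (b j)\<^sup>2 / 2 * of_bool (j = - i)"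
        by auto
    qed
    also have "\<dots> = (\<Sum>i\<in>\<Lambda>. \<Sum>j\<in>\<Lambda>. (b i)\<^sup>2 / 2 * of_bool (j = - i))
        + (\<Sum>i\<in>\<Lambda>. \<Sum>j\<in>\<Lambda>. (b j)\<^sup>2 / 2 * of_bool (j = - i))"
      by (simp only: sum.distrib)
    also have "(\<Sum>i\<in>\<Lambda>. \<Sum>j\<in>\<Lambda>. (b j)\<^sup>2 / 2 * of_bool (j = - i)) =
        (\<Sum>j\<in>\<Lambda>. \<Sum>i\<in>\<Lambda>. (b j)\<^sup>2 / 2 * of_bool (j = - i))"
      by (rule sum.swap)
    also have "(\<Sum>i\<in>\<Lambda>. \<Sum>j\<in>\<Lambda>. (b i)\<^sup>2 / 2 * of_bool (j = - i)) + \<dots> =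
        (\<Sum>i\<in>\<Lambda>. (b i)\<^sup>2 / 2 * (\<Sum>j\<in>\<Lambda>. of_bool (j = - i))) + (\<Sum>j\<in>\<Lambda>. (b j)\<^sup>2 / 2 * (\<Sum>i\<in>\<Lambda>. of_bool (j = - i)))"
      by (simp only: sum_distrib_left)
    also have "\<dots> \<le> (\<Sum>i\<in>\<Lambda>. (b i)\<^sup>2 / 2) + (\<Sum>j\<in>\<Lambda>. (b j)\<^sup>2 / 2)"
      by (intro add_mono sum_mono mult_left_le one) auto
    finally show "?A \<le> ?s" by (simp flip: sum_divide_distrib)
  qed
  finally show ?thesis by simp
qed

text \<open>The square of the sum is an exponential sum over pairs r, with space frequency
  \<open>w r\<close> and time frequency \<open>v r\<close>. Expanding its squared modulus leaves, in
  the mean, the pairs of pairs on which both frequencies agree.\<close>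

lemma besicovitch_norm_is_propagated_sum:
  fixes b :: "real \<Rightarrow> complex"
  assumes fin: "finite \<Lambda>" and \<phi>: "only_pair_resonances \<phi>"
  obtains c where "besicovitch_norm_is 4 (\<lambda>(t, x). \<Sum>\<xi>\<in>\<Lambda>. b \<xi> * cis (\<xi> * x - t * \<phi> \<xi>)) c"
    "c \<le> 3 powr (1 / 4) * sqrt (\<Sum>\<xi>\<in>\<Lambda>. (norm (b \<xi>))\<^sup>2)"
proof -
  let ?P = "\<lambda>(t, x). \<Sum>\<xi>\<in>\<Lambda>. b \<xi> * cis (\<xi> * x - t * \<phi> \<xi>)"
  let ?s = "\<Sum>\<xi>\<in>\<Lambda>. (norm (b \<xi>))\<^sup>2"
  define J where "J = \<Lambda> \<times> \<Lambda>"
  define \<beta> where "\<beta> = (\<lambda>r. b (fst r) * b (snd r))"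
  define w where "w = (\<lambda>r::real \<times> real. fst r + snd r)"
  define v where "v = (\<lambda>r. \<phi> (fst r) + \<phi> (snd r))"
  have J: "finite J" using fin by (simp add: J_def)
  let ?E = "\<lambda>q (t, x). cis ((w (fst q) - w (snd q)) * x - t * (v (fst q) - v (snd q)))"
  let ?S = "\<lambda>y. \<Sum>q\<in>J \<times> J. \<beta> (fst q) * cnj (\<beta> (snd q)) * ?E q y"
  let ?res = "\<lambda>q. w (fst q) = w (snd q) \<and> v (fst q) = v (snd q)"
  \<comment> \<open>The limit of the fourth power means. Taking \<open>Re\<close> gives a real
    number without a separate proof that the resonant sum is real.\<close>
  define m where "m = Re (\<Sum>q\<in>J \<times> J. \<beta> (fst q) * cnj (\<beta> (snd q)) * of_bool (?res q))"
  have contE: "continuous_on UNIV (?E q)" for q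
    by (auto intro!: continuous_intros simp: case_prod_beta)
  have sq: "norm (?P y) powr 4 = Re (?S y)" for y
  proof -
    obtain t x where y: "y = (t, x)" by fastforce
    have PP: "?P y * ?P y = (\<Sum>r\<in>J. \<beta> r * cis (w r * x - t * v r))"
      unfolding J_def \<beta>_def w_def v_def y
      by (simp add: sum_product sum.cartesian_product case_prod_beta mult_ac cis_mult)
         (simp add: algebra_simps)
    have "norm (?P y) powr 4 = (norm (?P y * ?P y))\<^sup>2"
      by (simp add: norm_mult power2_eq_square power4_eq_xxxx)
    then have "complex_of_real (norm (?P y) powr 4) = complex_of_real ((norm (?P y * ?P y))\<^sup>2)"
      by (rule arg_cong)
    also have "\<dots> = (\<Sum>q\<in>J \<times> J. \<beta> (fst q) * cnj (\<beta> (snd q)) *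
        cis ((w (fst q) * x - t * v (fst q)) - (w (snd q) * x - t * v (snd q))))"
      unfolding PP by (rule norm_exp_sum_sq[OF J])
    also have "\<dots> = ?S y"
    proof -
      have "(w a * x - t * v a) - (w a' * x - t * v a') = (w a - w a') * x - t * (v a - v a')" for a a'
        by (simp add: algebra_simps)
      then show ?thesis by (simp only: y prod.case)
    qed
    finally have "complex_of_real (norm (?P y) powr 4) = ?S y" .
    then show ?thesis by (metis Re_complex_of_real)
  qed
  have "((\<lambda>L. \<Sum>q\<in>J \<times> J. \<beta> (fst q) * cnj (\<beta> (snd q)) * mean_value L (?E q)) \<longlongrightarrow>
      (\<Sum>q\<in>J \<times> J. \<beta> (fst q) * cnj (\<beta> (snd q)) * of_bool (?res q))) at_top"
  proof (intro tendsto_intros)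
    fix q
    show "((\<lambda>L. mean_value L (?E q)) \<longlongrightarrow> of_bool (?res q)) at_top"
      using mean_value_exp_plane[of "w (fst q) - w (snd q)" "v (fst q) - v (snd q)"]
      by (simp add: of_bool_def)
  qed
  then have "((\<lambda>L. Re (\<Sum>q\<in>J \<times> J. \<beta> (fst q) * cnj (\<beta> (snd q)) * mean_value L (?E q))) \<longlongrightarrow> m) at_top"
    unfolding m_def by (rule tendsto_Re)
  moreover have "mean_value L (\<lambda>y. norm (?P y) powr 4) =
      Re (\<Sum>q\<in>J \<times> J. \<beta> (fst q) * cnj (\<beta> (snd q)) * mean_value L (?E q))" for L
  proof -
    have "mean_value L (\<lambda>y. norm (?P y) powr 4) = Re (mean_value L ?S)"
      unfolding sq by (intro mean_value_Re continuous_on_sum continuous_on_mult continuous_on_const contE)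
    also have "mean_value L ?S = (\<Sum>q\<in>J \<times> J. \<beta> (fst q) * cnj (\<beta> (snd q)) * mean_value L (?E q))"
      using J by (intro mean_value_sum contE) auto
    finally show ?thesis .
  qed
  ultimately have lim: "((\<lambda>L. mean_value L (\<lambda>y. norm (?P y) powr 4)) \<longlongrightarrow> m) at_top"
    by simp
  then have norm: "besicovitch_norm_is 4 ?P (m powr (1 / 4))"
    by (intro besicovitch_norm_is_continuous) (auto intro!: continuous_intros simp: case_prod_beta)
  have "m \<le> norm (\<Sum>q\<in>J \<times> J. \<beta> (fst q) * cnj (\<beta> (snd q)) * of_bool (?res q))"
    unfolding m_def by (rule complex_Re_le_cmod)
  also have "\<dots> \<le> (\<Sum>q\<in>J \<times> J. case q of ((i, j), (k, l)) \<Rightarrow>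
      norm (b i) * norm (b j) * (norm (b k) * norm (b l)) * of_bool (i + j = k + l \<and> \<phi> i + \<phi> j = \<phi> k + \<phi> l))"
    by (rule sum_norm_le) (auto simp: \<beta>_def w_def v_def norm_mult)
  also have "\<dots> \<le> 3 * ?s\<^sup>2"
    unfolding J_def by (rule resonant_sum_le[OF fin \<phi>]) simp
  finally have m: "m \<le> 3 * ?s\<^sup>2" .
  \<comment> \<open>Monotonicity of the fourth root asks for a nonnegative base; m inherits the sign
    from the means converging to it.\<close>
  have "m \<ge> 0"
    using tendsto_lowerbound[OF lim, of 0]
      besicovitch_mean_continuous(2)[of ?P 4]
    by (force intro!: eventually_mono[OF eventually_gt_at_top[of 0]] continuous_intros simp: case_prod_beta)
  then have "m powr (1 / 4) \<le> (3 * ?s\<^sup>2) powr (1 / 4)"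
    using m by (intro powr_mono2) auto
  also have "\<dots> = 3 powr (1 / 4) * sqrt ?s"
  proof -
    have "?s \<ge> 0" by (intro sum_nonneg) auto
    then have "?s\<^sup>2 = ?s powr 2" by simp
    then have "(?s\<^sup>2) powr (1 / 4) = ?s powr (1 / 2)"
      by (simp only: powr_powr) simp
    then show ?thesis using \<open>?s \<ge> 0\<close> by (simp add: powr_mult powr_half_sqrt)
  qed
  finally show thesis using that norm by blast
qed

section \<open>Bessel's inequality\<close>

text \<open>The expression under the limit in \<open>bohr_fourier\<close>. It is named because
  \<open>Lim\<close> says nothing until convergence is known, and convergence is proved
  below.\<close>

definition fourier_mean :: "(real \<Rightarrow> complex) \<Rightarrow> real \<Rightarrow> real \<Rightarrow> complex" where
  "fourier_mean f \<xi> L = complex_of_real (1 / (2 * L)) *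
     (LINT x:{-L..L}|lebesgue. f x * cis (- (\<xi> * x)))"

lemma mean_norm_sq_eq_integral:
  fixes f :: "real \<Rightarrow> complex"
  assumes "f \<in> borel_measurable lebesgue" "L > 0" "besicovitch_mean 2 f L < \<infinity>"
  shows "integrable (lebesgue_on {-L..L}) (\<lambda>x. (norm (f x))\<^sup>2)"
    and "(mean_norm 2 f L)\<^sup>2 = (\<integral>x. (norm (f x))\<^sup>2 \<partial>lebesgue_on {-L..L}) / (2 * L)"
proof -
  let ?M = "lebesgue_on {-L..L}"
  have [measurable]: "f \<in> borel_measurable ?M"
    using assms(1) by (rule measurable_restrict_space1)
  have mean: "besicovitch_mean 2 f L = (\<integral>\<^sup>+x. ennreal ((norm (f x))\<^sup>2) \<partial>?M) / ennreal (2 * L)"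
    unfolding besicovitch_mean_eq by simp
  have "(\<integral>\<^sup>+x. ennreal ((norm (f x))\<^sup>2) \<partial>?M) < \<infinity>"
  proof (rule ccontr)
    assume "\<not> ?thesis"
    then have "(\<integral>\<^sup>+x. ennreal ((norm (f x))\<^sup>2) \<partial>?M) = \<infinity>"
      by (simp add: less_top[symmetric])
    then show False
      using assms(2,3) unfolding mean by (simp add: ennreal_top_divide)
  qed
  then show int: "integrable ?M (\<lambda>x. (norm (f x))\<^sup>2)"
    by (intro integrableI_nonneg) auto
  have "(mean_norm 2 f L)\<^sup>2 = enn2real (besicovitch_mean 2 f L)"
    by (simp add: mean_norm_def powr_half_sqrt)
  also have "(\<integral>\<^sup>+x. ennreal ((norm (f x))\<^sup>2) \<partial>?M) = ennreal (\<integral>x. (norm (f x))\<^sup>2 \<partial>?M)"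
    by (intro nn_integral_eq_integral int) auto
  then have "besicovitch_mean 2 f L = ennreal ((\<integral>x. (norm (f x))\<^sup>2 \<partial>?M) / (2 * L))"
    using assms(2) unfolding mean by (simp add: divide_ennreal)
  finally show "(mean_norm 2 f L)\<^sup>2 = (\<integral>x. (norm (f x))\<^sup>2 \<partial>?M) / (2 * L)"
    using assms(2) by simp
qed

text \<open>Expansion of the squared distance over a fixed interval: the cross term is linear in the
  truncated Fourier coefficients, so these can be recovered from norms.\<close>

lemma mean_norm_sq_diff_exp_sum:
  fixes u a :: "real \<Rightarrow> complex"
  assumes u: "u \<in> borel_measurable lebesgue" "besicovitch_mean 2 u L < \<infinity>" and "L > 0" "finite \<Lambda>"
  defines "P \<equiv> \<lambda>x. \<Sum>\<xi>\<in>\<Lambda>. a \<xi> * cis (\<xi> * x)"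
  shows "(mean_norm 2 (\<lambda>x. u x - P x) L)\<^sup>2 =
    (mean_norm 2 u L)\<^sup>2 - 2 * Re (\<Sum>\<xi>\<in>\<Lambda>. cnj (a \<xi>) * fourier_mean u \<xi> L) + (mean_norm 2 P L)\<^sup>2"
proof -
  let ?M = "lebesgue_on {-L..L}"
  have contP: "continuous_on UNIV P" unfolding P_def by (intro continuous_intros)
  have P: "P \<in> borel_measurable lebesgue"
    using contP by (intro measurable_completion) (simp add: borel_measurable_continuous_onI)
  have Pfin: "besicovitch_mean 2 P L < \<infinity>"
    using \<open>L > 0\<close> by (simp add: besicovitch_mean_continuous(1)[OF contP])
  have uP: "(\<lambda>x. u x - P x) \<in> borel_measurable lebesgue"
    using u(1) P by simp
  have "besicovitch_mean 2 (\<lambda>x. P x - u x) L < \<infinity>"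
  proof -
    have "besicovitch_mean 2 (\<lambda>x. - u x) L < \<infinity>"
      using u(2) by (simp add: besicovitch_mean_def)
    then show ?thesis
      using mean_norm_triangle(1)[OF P, of "\<lambda>x. - u x" 2 L] u(1) \<open>L > 0\<close> Pfin by simp
  qed
  then have uPfin: "besicovitch_mean 2 (\<lambda>x. u x - P x) L < \<infinity>"
    by (simp add: besicovitch_mean_minus_commute[of 2 u P])
  note Iu = mean_norm_sq_eq_integral[OF u(1) \<open>L > 0\<close> u(2)]
  note IP = mean_norm_sq_eq_integral[OF P \<open>L > 0\<close> Pfin]
  note IuP = mean_norm_sq_eq_integral[OF uP \<open>L > 0\<close> uPfin]
  have um: "u \<in> borel_measurable ?M"
    using u(1) by (rule measurable_restrict_space1)
  have int: "integrable ?M (\<lambda>x. u x * cis (- (\<xi> * x)))" for \<xi>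
  proof (rule Bochner_Integration.integrable_bound)
    show "integrable ?M (\<lambda>x. (norm (u x))\<^sup>2 + 1)"
      using Iu(1) by (intro Bochner_Integration.integrable_add) (auto simp: integrable_restrict_space)
    have "(\<lambda>x. cis (- (\<xi> * x))) \<in> borel_measurable ?M"
      by (intro measurable_restrict_space1 measurable_completion)
         (simp, intro borel_measurable_continuous_onI continuous_intros)
    then show "(\<lambda>x. u x * cis (- (\<xi> * x))) \<in> borel_measurable ?M"
      using um by simp
    \<comment> \<open>On a bounded interval square integrability implies integrability, through this
      elementary bound.\<close>
    have "t \<le> t\<^sup>2 + 1" for t :: real
      using sum_squares_bound[of t 1] by simp (smt (verit) zero_le_power2)
    then show "AE x in ?M. norm (u x * cis (- (\<xi> * x))) \<le> norm ((norm (u x))\<^sup>2 + 1)"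
      by (auto simp: norm_mult)
  qed
  have uPcnj: "u x * cnj (P x) = (\<Sum>\<xi>\<in>\<Lambda>. cnj (a \<xi>) * (u x * cis (- (\<xi> * x))))" for x
    by (simp add: P_def sum_distrib_left cis_cnj mult_ac)
  have int_uP: "integrable ?M (\<lambda>x. u x * cnj (P x))"
    unfolding uPcnj using int by (intro Bochner_Integration.integrable_sum integrable_mult_right)
  have "(\<integral>x. u x * cnj (P x) \<partial>?M) = (\<Sum>\<xi>\<in>\<Lambda>. cnj (a \<xi>) * (\<integral>x. u x * cis (- (\<xi> * x)) \<partial>?M))"
    unfolding uPcnj using int by (subst Bochner_Integration.integral_sum) auto
  also have "\<dots> = complex_of_real (2 * L) * (\<Sum>\<xi>\<in>\<Lambda>. cnj (a \<xi>) * fourier_mean u \<xi> L)"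
    using \<open>L > 0\<close>
    by (simp add: fourier_mean_def set_lebesgue_integral_def integral_restrict_space sum_distrib_left mult_ac)
  finally have Re: "(\<integral>x. Re (u x * cnj (P x)) \<partial>?M) = 2 * L * Re (\<Sum>\<xi>\<in>\<Lambda>. cnj (a \<xi>) * fourier_mean u \<xi> L)"
    by (subst integral_Re[OF int_uP]) simp
  define r where "r = (\<lambda>x. Re (u x * cnj (P x)))"
  have r: "integrable ?M r"
    unfolding r_def by (rule integrable_Re[OF int_uP])
  have "(norm (u x - P x))\<^sup>2 = (norm (u x))\<^sup>2 - 2 * r x + (norm (P x))\<^sup>2" for x
    unfolding cmod_power2 r_def by (simp add: power2_eq_square algebra_simps)
  then have "(\<integral>x. (norm (u x - P x))\<^sup>2 \<partial>?M) =
      (\<integral>x. (norm (u x))\<^sup>2 \<partial>?M) - 2 * (\<integral>x. r x \<partial>?M) + (\<integral>x. (norm (P x))\<^sup>2 \<partial>?M)"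
    using Iu(1) IP(1) r by simp
  then show ?thesis
    using \<open>L > 0\<close> unfolding Iu(2) IP(2) IuP(2) r_def Re by (simp add: field_simps)
qed

lemma eventually_besicovitch_mean_le:
  assumes "p \<ge> 1" "besicovitch_norm_is p f c" "c < a"
  shows "\<forall>\<^sub>F L in at_top. besicovitch_mean p f L \<le> ennreal (a powr p)"
proof -
  have "c \<ge> 0" using besicovitch_norm_isD(3)[OF assms(1,2)] .
  have "\<forall>\<^sub>F L in at_top. mean_norm p f L < a" "\<forall>\<^sub>F L in at_top. besicovitch_mean p f L < \<infinity>"
    using assms by (auto simp: besicovitch_norm_is_def dest: order_tendstoD)
  then show ?thesis
    by eventually_elim (use \<open>c \<ge> 0\<close> assms in \<open>auto simp: besicovitch_mean_le_powr_iff\<close>)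
qed

lemma trig_polynomials_add:
  assumes "P \<in> trig_polynomials" "Q \<in> trig_polynomials"
  shows "(\<lambda>x. P x + Q x) \<in> trig_polynomials"
proof -
  obtain A a where P: "finite A" "P = (\<lambda>x. \<Sum>\<xi>\<in>A. a \<xi> * cis (\<xi> * x))"
    using assms(1) by (auto simp: trig_polynomials_def)
  obtain B b where Q: "finite B" "Q = (\<lambda>x. \<Sum>\<xi>\<in>B. b \<xi> * cis (\<xi> * x))"
    using assms(2) by (auto simp: trig_polynomials_def)
  let ?c = "\<lambda>\<xi>. (if \<xi> \<in> A then a \<xi> else 0) + (if \<xi> \<in> B then b \<xi> else 0)"
  have "P x = (\<Sum>\<xi>\<in>A \<union> B. (if \<xi> \<in> A then a \<xi> else 0) * cis (\<xi> * x))" for x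
    unfolding P(2) using P(1) Q(1) by (intro sum.mono_neutral_cong_left) auto
  moreover have "Q x = (\<Sum>\<xi>\<in>A \<union> B. (if \<xi> \<in> B then b \<xi> else 0) * cis (\<xi> * x))" for x
    unfolding Q(2) using P(1) Q(1) by (intro sum.mono_neutral_cong_left) auto
  ultimately have "(\<lambda>x. P x + Q x) = (\<lambda>x. \<Sum>\<xi>\<in>A \<union> B. ?c \<xi> * cis (\<xi> * x))"
    by (simp add: distrib_right sum.distrib)
  then show ?thesis
    unfolding trig_polynomials_def mem_Collect_eq
    by (intro exI[of _ "A \<union> B"] exI[of _ ?c]) (simp add: P(1) Q(1))
qed

text \<open>Shifting the approximants along with u keeps the distance. The purpose is that the
  difference has a norm of its own, which polarization relies on.\<close>

lemma besicovitch_ap2_diff_exp_sum: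
  assumes "u \<in> besicovitch_ap2" "finite \<Lambda>"
  shows "(\<lambda>x. u x - (\<Sum>\<xi>\<in>\<Lambda>. a \<xi> * cis (\<xi> * x))) \<in> besicovitch_ap2"
proof -
  define Q where "Q = (\<lambda>x. \<Sum>\<xi>\<in>\<Lambda>. - a \<xi> * cis (\<xi> * x))"
  have Q: "Q \<in> trig_polynomials"
    unfolding trig_polynomials_def Q_def mem_Collect_eq
    by (rule exI[of _ \<Lambda>], rule exI[of _ "\<lambda>\<xi>. - a \<xi>"]) (simp add: assms(2))
  have "Q \<in> borel_measurable lebesgue"
    unfolding Q_def by (intro measurable_completion) (simp, intro borel_measurable_continuous_onI continuous_intros)
  then have "(\<lambda>x. u x + Q x) \<in> borel_measurable lebesgue"
    using assms(1) by (intro borel_measurable_add) (simp_all add: besicovitch_ap2_def)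
  moreover have "\<exists>P\<in>trig_polynomials. has_besicovitch_norm 2 (\<lambda>x. u x + Q x - P x) \<and>
      besicovitch_norm 2 (\<lambda>x. u x + Q x - P x) < \<epsilon>" if "\<epsilon> > 0" for \<epsilon>
  proof -
    obtain P where P: "P \<in> trig_polynomials" "has_besicovitch_norm 2 (\<lambda>x. u x - P x)"
      "besicovitch_norm 2 (\<lambda>x. u x - P x) < \<epsilon>"
      using assms(1) \<open>\<epsilon> > 0\<close> unfolding besicovitch_ap2_def by blast
    show ?thesis
      by (rule bexI[OF _ trig_polynomials_add[OF P(1) Q]]) (simp add: P(2,3))
  qed
  ultimately have "(\<lambda>x. u x + Q x) \<in> besicovitch_ap2"
    unfolding besicovitch_ap2_def mem_Collect_eq by (intro conjI allI impI)
  then show ?thesis unfolding Q_def by (simp add: sum_negf)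
qed

text \<open>The definition of the space grants norms of differences from trigonometric polynomials
  only; the norm of u itself arises as a limit of the explicit norms of the polynomials.\<close>

lemma besicovitch_ap2_norm:
  assumes "u \<in> besicovitch_ap2"
  shows "besicovitch_norm_is 2 u (besicovitch_norm 2 u)"
proof -
  obtain c where c: "besicovitch_norm_is 2 u c"
  proof (rule besicovitch_norm_is_limit[of 2 u])
    fix \<epsilon> :: real assume "\<epsilon> > 0"
    then obtain P where P: "P \<in> trig_polynomials" "has_besicovitch_norm 2 (\<lambda>x. u x - P x)"
      "besicovitch_norm 2 (\<lambda>x. u x - P x) < \<epsilon>"
      using assms unfolding besicovitch_ap2_def by blast
    obtain d where "besicovitch_norm_is 2 P d"
      using P(1) besicovitch_norm_is_exp_sum unfolding trig_polynomials_def by blast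
    moreover have "\<forall>\<^sub>F L in at_top. besicovitch_mean 2 (\<lambda>x. u x - P x) L \<le> ennreal (\<epsilon> powr 2)"
      by (rule eventually_besicovitch_mean_le[OF _ has_besicovitch_normD[OF _ P(2)] P(3)]) simp_all
    ultimately show "\<exists>g c. besicovitch_norm_is 2 g c \<and>
      (\<forall>\<^sub>F L in at_top. besicovitch_mean 2 (\<lambda>x. u x - g x) L \<le> ennreal (\<epsilon> powr 2))" by blast
  qed (use assms in \<open>auto simp: besicovitch_ap2_def\<close>)
  then show ?thesis
    using besicovitch_norm_isD(2)[OF _ c] by simp
qed

lemma ap2_mean_norm_sq_tendsto:
  assumes "u \<in> besicovitch_ap2"
  shows "((\<lambda>L. (mean_norm 2 u L)\<^sup>2) \<longlongrightarrow> (besicovitch_norm 2 u)\<^sup>2) at_top"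
  using besicovitch_ap2_norm[OF assms] by (auto simp: besicovitch_norm_is_def intro: tendsto_power)

text \<open>
  Polarization: taking \<open>a = 1\<close> and \<open>a = \<i>\<close> at a single frequency gives the existence of the Fourier
  coefficients, since all norms on the right-hand side are limits.
\<close>
lemma ap2_diff_exp_sum_tendsto:
  fixes a :: "real \<Rightarrow> complex"
  assumes u: "u \<in> besicovitch_ap2" and \<Lambda>: "finite \<Lambda>"
  shows "((\<lambda>L. Re (\<Sum>\<xi>\<in>\<Lambda>. cnj (a \<xi>) * fourier_mean u \<xi> L)) \<longlongrightarrow>
    ((besicovitch_norm 2 u)\<^sup>2 + (\<Sum>\<xi>\<in>\<Lambda>. (norm (a \<xi>))\<^sup>2) -
      (besicovitch_norm 2 (\<lambda>x. u x - (\<Sum>\<xi>\<in>\<Lambda>. a \<xi> * cis (\<xi> * x))))\<^sup>2) / 2) at_top"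
proof -
  let ?P = "\<lambda>x. \<Sum>\<xi>\<in>\<Lambda>. a \<xi> * cis (\<xi> * x)"
  have "((\<lambda>L. (mean_norm 2 ?P L)\<^sup>2) \<longlongrightarrow> (sqrt (\<Sum>\<xi>\<in>\<Lambda>. (norm (a \<xi>))\<^sup>2))\<^sup>2) at_top"
    using besicovitch_norm_is_exp_sum[OF \<Lambda>, of a] by (auto simp: besicovitch_norm_is_def intro: tendsto_power)
  also have "(sqrt (\<Sum>\<xi>\<in>\<Lambda>. (norm (a \<xi>))\<^sup>2))\<^sup>2 = (\<Sum>\<xi>\<in>\<Lambda>. (norm (a \<xi>))\<^sup>2)"
    by (simp add: sum_nonneg)
  finally have P: "((\<lambda>L. (mean_norm 2 ?P L)\<^sup>2) \<longlongrightarrow> (\<Sum>\<xi>\<in>\<Lambda>. (norm (a \<xi>))\<^sup>2)) at_top" .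
  have "((\<lambda>L. ((mean_norm 2 u L)\<^sup>2 + (mean_norm 2 ?P L)\<^sup>2 - (mean_norm 2 (\<lambda>x. u x - ?P x) L)\<^sup>2) / 2) \<longlongrightarrow>
    ((besicovitch_norm 2 u)\<^sup>2 + (\<Sum>\<xi>\<in>\<Lambda>. (norm (a \<xi>))\<^sup>2) - (besicovitch_norm 2 (\<lambda>x. u x - ?P x))\<^sup>2) / 2) at_top"
    by (intro tendsto_intros P ap2_mean_norm_sq_tendsto besicovitch_ap2_diff_exp_sum u \<Lambda>) simp
  then show ?thesis
  proof (rule Lim_transform_eventually)
    have "\<forall>\<^sub>F L in at_top. besicovitch_mean 2 u L < \<infinity>"
      using besicovitch_ap2_norm[OF u] by (auto simp: besicovitch_norm_is_def)
    with eventually_gt_at_top[of 0]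
    show "\<forall>\<^sub>F L in at_top. ((mean_norm 2 u L)\<^sup>2 + (mean_norm 2 ?P L)\<^sup>2 - (mean_norm 2 (\<lambda>x. u x - ?P x) L)\<^sup>2) / 2 =
      Re (\<Sum>\<xi>\<in>\<Lambda>. cnj (a \<xi>) * fourier_mean u \<xi> L)"
    proof eventually_elim
      case (elim L)
      have "u \<in> borel_measurable lebesgue" using u by (simp add: besicovitch_ap2_def)
      from mean_norm_sq_diff_exp_sum[OF this elim(2,1) \<Lambda>, of a] show ?case by simp
    qed
  qed
qed

lemma fourier_mean_tendsto:
  assumes "u \<in> besicovitch_ap2"
  shows "(fourier_mean u \<xi> \<longlongrightarrow> bohr_fourier u \<xi>) at_top"
proof -
  obtain r where "((\<lambda>L. Re (fourier_mean u \<xi> L)) \<longlongrightarrow> r) at_top"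
    using ap2_diff_exp_sum_tendsto[OF assms, of "{\<xi>}" "\<lambda>_. 1"] by auto
  \<comment> \<open>The coefficient i turns the real part into the imaginary part, as Re (cnj i * z)
    = Im z.\<close>
  moreover obtain s where "((\<lambda>L. Im (fourier_mean u \<xi> L)) \<longlongrightarrow> s) at_top"
    using ap2_diff_exp_sum_tendsto[OF assms, of "{\<xi>}" "\<lambda>_. \<i>"] by auto
  ultimately have "(fourier_mean u \<xi> \<longlongrightarrow> Complex r s) at_top"
    by (simp add: tendsto_complex_iff)
  then show ?thesis
    using tendsto_Lim[of at_top "fourier_mean u \<xi>" "Complex r s"]
    unfolding bohr_fourier_def fourier_mean_def[abs_def] by simp
qed

text \<open>With the Fourier coefficients as a, the cross term converges to the sum s of their
  squared moduli. The polarization limit then reads: s is the squared norm of u minus the squared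
  norm of the remainder.\<close>

lemma bessel_inequality:
  assumes u: "u \<in> besicovitch_ap2" and \<Lambda>: "finite \<Lambda>"
  shows "(\<Sum>\<xi>\<in>\<Lambda>. (norm (bohr_fourier u \<xi>))\<^sup>2) \<le> (besicovitch_norm 2 u)\<^sup>2"
proof -
  let ?a = "bohr_fourier u"
  let ?s = "\<Sum>\<xi>\<in>\<Lambda>. (norm (?a \<xi>))\<^sup>2"
  have "((\<lambda>L. Re (\<Sum>\<xi>\<in>\<Lambda>. cnj (?a \<xi>) * fourier_mean u \<xi> L)) \<longlongrightarrow> Re (\<Sum>\<xi>\<in>\<Lambda>. cnj (?a \<xi>) * ?a \<xi>)) at_top"
    by (intro tendsto_intros fourier_mean_tendsto u)
  moreover have "Re (\<Sum>\<xi>\<in>\<Lambda>. cnj (?a \<xi>) * ?a \<xi>) = ?s"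
    unfolding cmod_power2 by (simp add: power2_eq_square)
  ultimately have "?s = ((besicovitch_norm 2 u)\<^sup>2 + ?s -
      (besicovitch_norm 2 (\<lambda>x. u x - (\<Sum>\<xi>\<in>\<Lambda>. ?a \<xi> * cis (\<xi> * x))))\<^sup>2) / 2"
    using tendsto_unique[OF _ _ ap2_diff_exp_sum_tendsto[OF u \<Lambda>, of ?a]] by simp
  then show ?thesis
    using zero_le_power2[of "besicovitch_norm 2 (\<lambda>x. u x - (\<Sum>\<xi>\<in>\<Lambda>. ?a \<xi> * cis (\<xi> * x)))"]
    by argo
qed

text \<open>Take A whose sum is within \<epsilon> of the supremum over all finite sets; a disjoint
  set can add only what is left.\<close>

lemma finite_set_small_tail:
  fixes f :: "'i \<Rightarrow> real"
  assumes nonneg: "\<And>i. f i \<ge> 0" and bound: "\<And>A. finite A \<Longrightarrow> sum f A \<le> C" and "\<epsilon> > 0"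
  obtains A where "finite A" "\<And>B. finite B \<Longrightarrow> B \<inter> A = {} \<Longrightarrow> sum f B < \<epsilon>"
proof -
  let ?S = "sum f ` Collect finite"
  have bdd: "bdd_above ?S" using bound by (intro bdd_aboveI2[of _ _ C]) auto
  have "Sup ?S - \<epsilon> < Sup ?S" using \<open>\<epsilon> > 0\<close> by simp
  then obtain A where A: "finite A" "Sup ?S - \<epsilon> < sum f A"
    using less_cSup_iff[OF _ bdd, of "Sup ?S - \<epsilon>"] by blast
  show thesis
  proof
    fix B assume B: "finite B" "B \<inter> A = {}"
    then have "sum f (A \<union> B) \<le> Sup ?S"
      using A(1) bdd by (intro cSup_upper) auto
    moreover have "sum f (A \<union> B) = sum f A + sum f B"
      using A(1) B by (intro sum.union_disjoint) auto
    ultimately show "sum f B < \<epsilon>" using A(2) by linarith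
  qed (rule A(1))
qed

section \<open>Series of exponentials\<close>

text \<open>Isolates the sole analytic input to the convergence theory of series: the norm of a
  finite sum exists and is controlled by the l^2 norm of its coefficients. It is instantiated with p
  = 4 in space-time and with p = 2 on each time slice.\<close>

locale exponential_family =
  fixes p C :: real and e :: "real \<Rightarrow> 'a::euclidean_space \<Rightarrow> complex"
  assumes p_ge_1: "p \<ge> 1" and C_nonneg: "C \<ge> 0"
    and exp_sum_bound: "finite \<Lambda> \<Longrightarrow>
      \<exists>c. besicovitch_norm_is p (\<lambda>y. \<Sum>\<xi>\<in>\<Lambda>. b \<xi> * e \<xi> y) c \<and> c \<le> C * sqrt (\<Sum>\<xi>\<in>\<Lambda>. (norm (b \<xi>))\<^sup>2)"
begin

lemma exp_sum_measurable:
  "finite \<Lambda> \<Longrightarrow> (\<lambda>y. \<Sum>\<xi>\<in>\<Lambda>. b \<xi> * e \<xi> y) \<in> borel_measurable lebesgue"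
  using exp_sum_bound[of \<Lambda> b] by (auto simp: besicovitch_norm_is_def)

text \<open>F is a limit of finite sums whose norms are at most C B. Both existence of the norm and
  the bound survive the limit.\<close>

lemma has_besicovitch_sum_bound:
  assumes sum: "has_besicovitch_sum p (\<lambda>\<xi> y. a \<xi> * e \<xi> y) F"
    and "B \<ge> 0" and a: "\<And>\<Lambda>. finite \<Lambda> \<Longrightarrow> (\<Sum>\<xi>\<in>\<Lambda>. (norm (a \<xi>))\<^sup>2) \<le> B\<^sup>2"
  shows "has_besicovitch_norm p F" "besicovitch_norm p F \<le> C * B"
proof -
  let ?S = "\<lambda>\<Lambda> y. \<Sum>\<xi>\<in>\<Lambda>. a \<xi> * e \<xi> y"
  have approx: "\<exists>\<Lambda>. finite \<Lambda> \<and> has_besicovitch_norm p (\<lambda>y. F y - ?S \<Lambda> y) \<and>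
      (\<forall>\<^sub>F L in at_top. besicovitch_mean p (\<lambda>y. F y - ?S \<Lambda> y) L \<le> ennreal (\<epsilon> powr p))" if "\<epsilon> > 0" for \<epsilon>
  proof -
    have "\<forall>\<^sub>F \<Lambda> in finite_subsets_at_top UNIV. has_besicovitch_norm p (\<lambda>y. F y - ?S \<Lambda> y) \<and>
        besicovitch_norm p (\<lambda>y. F y - ?S \<Lambda> y) < \<epsilon>"
      using sum that unfolding has_besicovitch_sum_def by simp
    then obtain \<Lambda> where \<Lambda>: "finite \<Lambda>" "has_besicovitch_norm p (\<lambda>y. F y - ?S \<Lambda> y)"
        "besicovitch_norm p (\<lambda>y. F y - ?S \<Lambda> y) < \<epsilon>"
      unfolding eventually_finite_subsets_at_top by blast
    then show ?thesis
      using eventually_besicovitch_mean_le[OF p_ge_1 has_besicovitch_normD[OF p_ge_1 \<Lambda>(2)] \<Lambda>(3)] by auto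
  qed
  have meas: "F \<in> borel_measurable lebesgue"
  proof -
    obtain \<Lambda> where "finite \<Lambda>" "(\<lambda>y. F y - ?S \<Lambda> y) \<in> borel_measurable lebesgue"
      using approx[of 1] by (auto simp: has_besicovitch_norm_def)
    then have "(\<lambda>y. (F y - ?S \<Lambda> y) + ?S \<Lambda> y) \<in> borel_measurable lebesgue"
      by (intro borel_measurable_add exp_sum_measurable)
    then show ?thesis by simp
  qed
  have bound: "\<exists>d. besicovitch_norm_is p (?S \<Lambda>) d \<and> d \<le> C * B" if "finite \<Lambda>" for \<Lambda>
  proof -
    have "sqrt (\<Sum>\<xi>\<in>\<Lambda>. (norm (a \<xi>))\<^sup>2) \<le> B"
      using a[OF that] \<open>B \<ge> 0\<close> by (rule real_le_lsqrt[rotated])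
    then show ?thesis
      using exp_sum_bound[OF that, of a] mult_left_mono[OF _ C_nonneg] by (meson order_trans)
  qed
  obtain c where c: "besicovitch_norm_is p F c"
  proof (rule besicovitch_norm_is_limit[OF p_ge_1 meas])
    fix \<epsilon> :: real assume "\<epsilon> > 0"
    then obtain \<Lambda> where \<Lambda>: "finite \<Lambda>"
      "\<forall>\<^sub>F L in at_top. besicovitch_mean p (\<lambda>y. F y - ?S \<Lambda> y) L \<le> ennreal (\<epsilon> powr p)"
      using approx by metis
    then obtain d where "besicovitch_norm_is p (?S \<Lambda>) d" using bound by metis
    with \<Lambda>(2) show "\<exists>g c. besicovitch_norm_is p g c \<and>
        (\<forall>\<^sub>F L in at_top. besicovitch_mean p (\<lambda>x. F x - g x) L \<le> ennreal (\<epsilon> powr p))"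
      by (intro exI[of _ "?S \<Lambda>"] exI[of _ d] conjI)
  qed
  have "c \<le> C * B + \<epsilon>" if pos: "\<epsilon> > 0" for \<epsilon>
  proof -
    obtain \<Lambda> where \<Lambda>: "finite \<Lambda>"
      "\<forall>\<^sub>F L in at_top. besicovitch_mean p (\<lambda>y. F y - ?S \<Lambda> y) L \<le> ennreal (\<epsilon> powr p)"
      using approx[OF pos] by metis
    obtain d where d: "besicovitch_norm_is p (?S \<Lambda>) d" "d \<le> C * B" using bound[OF \<Lambda>(1)] by metis
    have "\<bar>c - d\<bar> \<le> \<epsilon>"
      using pos by (intro besicovitch_norm_is_close[OF p_ge_1 c d(1) _ \<Lambda>(2)]) simp
    then show ?thesis using d(2) by linarith
  qed
  then have "c \<le> C * B" by (rule field_le_epsilon)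
  then show "has_besicovitch_norm p F" "besicovitch_norm p F \<le> C * B"
    using besicovitch_norm_isD[OF p_ge_1 c] by auto
qed

text \<open>The definition asks for convergence along all finite sets, whereas a patched function is
  compared with the sets \<open>\<Lambda> n\<close> only. The gap is closed by the tails: a finite A
  containing \<open>\<Lambda> n\<close> changes the sum by a function of norm at most C sqrt
  (\<open>\<eta> n\<close>).\<close>

lemma has_besicovitch_sumI:
  assumes F: "F \<in> borel_measurable lebesgue"
    and fin: "\<And>n. finite (\<Lambda> n)"
    and tail: "\<And>n A. finite A \<Longrightarrow> A \<inter> \<Lambda> n = {} \<Longrightarrow> (\<Sum>\<xi>\<in>A. (norm (a \<xi>))\<^sup>2) \<le> \<eta> n"
    and \<eta>: "\<eta> \<longlonglongrightarrow> 0"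
    and approx: "\<And>\<epsilon>. \<epsilon> > 0 \<Longrightarrow> \<forall>\<^sub>F n in sequentially. \<forall>\<^sub>F L in at_top.
      besicovitch_mean p (\<lambda>y. F y - (\<Sum>\<xi>\<in>\<Lambda> n. a \<xi> * e \<xi> y)) L \<le> ennreal (\<epsilon> powr p)"
  shows "has_besicovitch_sum p (\<lambda>\<xi> y. a \<xi> * e \<xi> y) F"
  unfolding has_besicovitch_sum_def
proof (intro allI impI)
  fix \<epsilon> :: real assume "\<epsilon> > 0"
  let ?S = "\<lambda>A y. \<Sum>\<xi>\<in>A. a \<xi> * e \<xi> y"
  have ex: "\<exists>c. besicovitch_norm_is p (\<lambda>y. F y - ?S A y) c" if A: "finite A" for A
  proof -
    have meas: "(\<lambda>y. F y - ?S A y) \<in> borel_measurable lebesgue"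
      using F exp_sum_measurable[OF A] by (rule borel_measurable_diff)
    obtain c where "besicovitch_norm_is p (\<lambda>y. F y - ?S A y) c"
    proof (rule besicovitch_norm_is_limit[OF p_ge_1 meas])
      fix \<delta> :: real assume "\<delta> > 0"
      then obtain n where n: "\<forall>\<^sub>F L in at_top. besicovitch_mean p (\<lambda>y. F y - ?S (\<Lambda> n) y) L \<le> ennreal (\<delta> powr p)"
        using eventually_happens'[OF _ approx] by auto
      \<comment> \<open>Extending both coefficient families by zero to the union presents the
        difference of two partial sums as one exponential sum, which has a norm.\<close>
      let ?b = "\<lambda>\<xi>. (if \<xi> \<in> \<Lambda> n then a \<xi> else 0) - (if \<xi> \<in> A then a \<xi> else 0)"
      have "?S (\<Lambda> n) y = (\<Sum>\<xi>\<in>\<Lambda> n \<union> A. (if \<xi> \<in> \<Lambda> n then a \<xi> else 0) * e \<xi> y)" for y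
        using fin A by (intro sum.mono_neutral_cong_left) auto
      moreover have "?S A y = (\<Sum>\<xi>\<in>\<Lambda> n \<union> A. (if \<xi> \<in> A then a \<xi> else 0) * e \<xi> y)" for y
        using fin A by (intro sum.mono_neutral_cong_left) auto
      ultimately have eq: "(\<lambda>y. \<Sum>\<xi>\<in>\<Lambda> n \<union> A. ?b \<xi> * e \<xi> y) = (\<lambda>y. ?S (\<Lambda> n) y - ?S A y)"
        by (simp only: left_diff_distrib sum_subtractf)
      have "finite (\<Lambda> n \<union> A)" using fin A by simp
      from exp_sum_bound[OF this, of ?b] obtain d
        where d: "besicovitch_norm_is p (\<lambda>y. ?S (\<Lambda> n) y - ?S A y) d"
        unfolding eq by metis
      have "(\<lambda>y. (F y - ?S A y) - (?S (\<Lambda> n) y - ?S A y)) = (\<lambda>y. F y - ?S (\<Lambda> n) y)"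
        by simp
      with n d show "\<exists>g c. besicovitch_norm_is p g c \<and>
          (\<forall>\<^sub>F L in at_top. besicovitch_mean p (\<lambda>y. F y - ?S A y - g y) L \<le> ennreal (\<delta> powr p))"
        by (intro exI[of _ "\<lambda>y. ?S (\<Lambda> n) y - ?S A y"] exI[of _ d]) simp
    qed
    then show ?thesis ..
  qed
  have "(\<lambda>n. C * sqrt (\<eta> n)) \<longlonglongrightarrow> C * sqrt 0"
    by (intro tendsto_intros \<eta>)
  then have "\<forall>\<^sub>F n in sequentially. C * sqrt (\<eta> n) < \<epsilon> / 3"
    using \<open>\<epsilon> > 0\<close> by (intro order_tendstoD(2)) auto
  moreover have "\<forall>\<^sub>F n in sequentially. \<forall>\<^sub>F L in at_top.
      besicovitch_mean p (\<lambda>y. F y - ?S (\<Lambda> n) y) L \<le> ennreal ((\<epsilon> / 3) powr p)"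
    using \<open>\<epsilon> > 0\<close> by (intro approx) simp
  ultimately have "\<forall>\<^sub>F n in sequentially. C * sqrt (\<eta> n) < \<epsilon> / 3 \<and> (\<forall>\<^sub>F L in at_top.
      besicovitch_mean p (\<lambda>y. F y - ?S (\<Lambda> n) y) L \<le> ennreal ((\<epsilon> / 3) powr p))"
    by (rule eventually_conj)
  from eventually_happens'[OF sequentially_bot this] obtain n where n: "C * sqrt (\<eta> n) < \<epsilon> / 3"
    "\<forall>\<^sub>F L in at_top. besicovitch_mean p (\<lambda>y. F y - ?S (\<Lambda> n) y) L \<le> ennreal ((\<epsilon> / 3) powr p)"
    by (elim exE conjE)
  have "has_besicovitch_norm p (\<lambda>y. F y - ?S A y) \<and> besicovitch_norm p (\<lambda>y. F y - ?S A y) < \<epsilon>"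
    if A: "finite A" "\<Lambda> n \<subseteq> A" for A
  proof -
    obtain c where c: "besicovitch_norm_is p (\<lambda>y. F y - ?S A y) c" using ex[OF A(1)] by metis
    have "finite (A - \<Lambda> n)" using A(1) by simp
    from exp_sum_bound[OF this, of "\<lambda>\<xi>. - a \<xi>"] obtain d where
      d: "besicovitch_norm_is p (\<lambda>y. \<Sum>\<xi>\<in>A - \<Lambda> n. - a \<xi> * e \<xi> y) d"
        "d \<le> C * sqrt (\<Sum>\<xi>\<in>A - \<Lambda> n. (norm (- a \<xi>))\<^sup>2)"
      by (elim exE conjE)
    have "(\<Sum>\<xi>\<in>A - \<Lambda> n. (norm (- a \<xi>))\<^sup>2) \<le> \<eta> n"
      unfolding norm_minus_cancel using A(1) by (intro tail) auto
    then have "d \<le> C * sqrt (\<eta> n)"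
      by (rule order_trans[OF d(2) mult_left_mono[OF real_sqrt_le_mono C_nonneg]])
    then have "d < \<epsilon> / 3" using n(1) by linarith
    have "?S A y = ?S (A - \<Lambda> n) y + ?S (\<Lambda> n) y" for y
      using A by (intro sum.subset_diff) auto
    then have "(\<lambda>y. (F y - ?S A y) - (\<Sum>\<xi>\<in>A - \<Lambda> n. - a \<xi> * e \<xi> y)) = (\<lambda>y. F y - ?S (\<Lambda> n) y)"
      by (simp add: sum_negf)
    then have "\<bar>c - d\<bar> \<le> \<epsilon> / 3"
      using n(2) \<open>\<epsilon> > 0\<close> by (intro besicovitch_norm_is_close[OF p_ge_1 c d(1)]) simp_all
    then have "c < \<epsilon>" using \<open>d < \<epsilon> / 3\<close> \<open>\<epsilon> > 0\<close> by linarith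
    then show ?thesis using besicovitch_norm_isD[OF p_ge_1 c] by simp
  qed
  then show "\<forall>\<^sub>F A in finite_subsets_at_top UNIV. has_besicovitch_norm p (\<lambda>y. F y - ?S A y) \<and>
      besicovitch_norm p (\<lambda>y. F y - ?S A y) < \<epsilon>"
    unfolding eventually_finite_subsets_at_top using fin[of n] by (intro exI[of _ "\<Lambda> n"]) simp
qed

end

section \<open>Patching partial sums\<close>

lemma doubling_sequence_mono:
  fixes R :: "nat \<Rightarrow> real"
  assumes "\<And>n. R n > 0" "\<And>n. 2 * R n \<le> R (Suc n)" "m \<le> n"
  shows "R m \<le> R n"
  using assms(3) by (rule lift_Suc_mono_le[rotated]) (smt (verit) assms(1,2))

lemma doubling_sequence_unbounded:
  fixes R :: "nat \<Rightarrow> real"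
  assumes "\<And>n. R n > 0" "\<And>n. 2 * R n \<le> R (Suc n)"
  shows "\<exists>n. s < R n"
proof -
  have pow: "R 0 * 2 ^ n \<le> R n" for n
  proof (induction n)
    case (Suc n)
    then show ?case using assms(2)[of n] by simp
  qed simp
  obtain n where "s / R 0 < 2 ^ n" using real_arch_pow[of 2 "s / R 0"] by auto
  then have "s < R 0 * 2 ^ n" using assms(1)[of 0] by (simp add: field_simps)
  then show ?thesis using pow[of n] by (intro exI[of _ n]) linarith
qed

text \<open>The integral is built up shell by shell: outside \<open>cube (R n)\<close> the function
  is \<open>S n\<close>, so a shell costs at most c times the volume of the outer cube. The factor 4
  consists of 2 for the completed shells, 1 for the shell in progress and 1 for the constant
  contribution of \<open>cube (R k)\<close>, which is absorbed once L is large.\<close>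

lemma besicovitch_mean_patched_le:
  fixes F :: "'a::euclidean_space \<Rightarrow> complex" and R :: "nat \<Rightarrow> real"
  assumes p: "p \<ge> 1" and F: "F \<in> borel_measurable lebesgue"
    and S: "\<And>n. S n \<in> borel_measurable lebesgue"
    and R0: "\<And>n. R n > 0" and R: "\<And>n. 2 * R n \<le> R (Suc n)"
    and patch: "\<And>n y. k \<le> n \<Longrightarrow> y \<in> cube (R (Suc n)) \<Longrightarrow> y \<notin> cube (R n) \<Longrightarrow> F y = S n y"
    and c: "c > 0" and mean: "\<And>n L. k \<le> n \<Longrightarrow> R n \<le> L \<Longrightarrow>
      besicovitch_mean p (\<lambda>y. S n y - S k y) L \<le> ennreal c"
    and B: "\<And>y. y \<in> cube (R k) \<Longrightarrow> norm (F y - S k y) \<le> B"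
  shows "\<forall>\<^sub>F L in at_top. besicovitch_mean p (\<lambda>y. F y - S k y) L \<le> ennreal (4 * c)"
proof -
  note [measurable] = F S
  have [measurable]: "cube L \<in> sets (lebesgue :: 'a measure)" for L
    by simp
  define V where "V L = (2 * L) ^ DIM('a)" for L :: real
  define I where "I f L = (\<integral>\<^sup>+x. ennreal (norm (f x) powr p) * indicator (cube L) x \<partial>lebesgue)"
    for f :: "'a \<Rightarrow> complex" and L
  have mean_iff: "besicovitch_mean p f L \<le> ennreal m \<longleftrightarrow> I f L \<le> ennreal (m * V L)"
    if "L > 0" "m \<ge> 0" for f :: "'a \<Rightarrow> complex" and L m
    using that by (simp add: besicovitch_mean_le_iff I_def V_def nn_integral_restrict_space ennreal_mult)
  let ?f = "\<lambda>y. F y - S k y"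
  have V0: "V L > 0" if "L > 0" for L using that by (simp add: V_def)
  have V_mono: "V L \<le> V L'" if "0 < L" "L \<le> L'" for L L'
    using that by (auto simp: V_def intro: power_mono)
  have V2: "2 * V L \<le> V L'" if "0 < L" "2 * L \<le> L'" for L L'
  proof -
    have "2 * V L \<le> 2 ^ DIM('a) * V L"
      using V0[OF that(1)] self_le_power[of "2::real" "DIM('a)"] by (intro mult_right_mono) auto
    also have "\<dots> = V (2 * L)" by (simp only: V_def power_mult_distrib[symmetric])
    also have "\<dots> \<le> V L'" using that by (intro V_mono) auto
    finally show ?thesis .
  qed
  have shell: "I ?f L \<le> I ?f (R n) + ennreal (c * V L)" if "k \<le> n" "R n \<le> L" "L \<le> R (Suc n)" for n L
  proof -
    have "L > 0" using R0[of n] that by linarith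
    have "I ?f L \<le> (\<integral>\<^sup>+x. ennreal (norm (?f x) powr p) * indicator (cube (R n)) x
        + ennreal (norm (S n x - S k x) powr p) * indicator (cube L) x \<partial>lebesgue)"
      unfolding I_def
    proof (rule nn_integral_mono)
      fix x :: 'a
      have "x \<in> cube (R (Suc n))" if "x \<in> cube L"
        using that \<open>L \<le> R (Suc n)\<close>
        by (force simp: mem_box)
      then show "ennreal (norm (?f x) powr p) * indicator (cube L) x \<le>
          ennreal (norm (?f x) powr p) * indicator (cube (R n)) x
          + ennreal (norm (S n x - S k x) powr p) * indicator (cube L) x"
        using patch[OF \<open>k \<le> n\<close>, of x] by (auto simp: indicator_def)
    qed
    also have "\<dots> = I ?f (R n) + I (\<lambda>x. S n x - S k x) L"
      unfolding I_def by (intro nn_integral_add) measurable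
    also have "I (\<lambda>x. S n x - S k x) L \<le> ennreal (c * V L)"
      using mean[OF that(1,2)] \<open>L > 0\<close> c by (simp add: mean_iff)
    finally show ?thesis by (simp add: add_left_mono)
  qed
  \<comment> \<open>The part on which nothing is known beyond boundedness; it is finite and
    independent of L.\<close>
  define K where "K = enn2real (I ?f (R k))"
  have "I ?f (R k) \<le> (\<integral>\<^sup>+x. ennreal (\<bar>B\<bar> powr p) * indicator (cube (R k) :: 'a set) x \<partial>lebesgue)"
    unfolding I_def using B p
    by (intro nn_integral_mono) (fastforce simp: indicator_def intro!: ennreal_leI powr_mono2)
  also have "\<dots> = ennreal (\<bar>B\<bar> powr p) * emeasure lebesgue (cube (R k) :: 'a set)"
    by (rule nn_integral_cmult_indicator) simp
  also have "\<dots> < \<infinity>"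
    by (simp add: ennreal_mult_less_top emeasure_lborel_cbox_eq)
  finally have K: "I ?f (R k) = ennreal K" by (simp add: K_def)
  have "K \<ge> 0" by (simp add: K_def)
  \<comment> \<open>The factor 2 is the fixed point of the recursion: 2 V (R n) + V (R (n + 1)) is
    at most 2 V (R (n + 1)), since volumes at least double.\<close>
  have at_R: "I ?f (R n) \<le> ennreal (K + 2 * c * V (R n))" if "k \<le> n" for n
    using that
  proof (induction n rule: dec_induct)
    case base
    then show ?case using K V0[OF R0[of k]] c by (simp add: ennreal_leI)
  next
    case (step n)
    have "R n \<le> R (Suc n)" using R[of n] R0[of n] by linarith
    then have "I ?f (R (Suc n)) \<le> I ?f (R n) + ennreal (c * V (R (Suc n)))"
      using \<open>k \<le> n\<close> by (intro shell) auto
    also have "\<dots> \<le> ennreal (K + 2 * c * V (R n)) + ennreal (c * V (R (Suc n)))"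
      using step.IH by (rule add_right_mono)
    also have "\<dots> = ennreal (K + 2 * c * V (R n) + c * V (R (Suc n)))"
      using \<open>K \<ge> 0\<close> c V0[OF R0[of n]] V0[OF R0[of "Suc n"]] by (intro ennreal_plus[symmetric]) auto
    also have "\<dots> \<le> ennreal (K + 2 * c * V (R (Suc n)))"
      using mult_left_mono[OF V2[OF R0[of n] R[of n]], of c] c by (intro ennreal_leI) (simp add: algebra_simps)
    finally show ?case .
  qed
  note monoR = doubling_sequence_mono[of R, OF R0 R]
  have all: "I ?f L \<le> ennreal (K + 3 * c * V L)" if "R k \<le> L" for L
  proof -
    \<comment> \<open>Minimality puts L into the shell from R (n - 1) to R n, and monotonicity of R
      gives k < n.\<close>
    define n where "n = (LEAST n. L < R n)"
    have n: "L < R n"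
      unfolding n_def using doubling_sequence_unbounded[of R, OF R0 R] by (rule LeastI_ex)
    then have "k < n" using monoR[of n k] that by (meson leD not_le order.strict_trans2)
    then obtain m where m: "n = Suc m" "k \<le> m" by (cases n) auto
    have "R m \<le> L"
      using not_less_Least[of m "\<lambda>n. L < R n"] m(1) unfolding n_def by (metis lessI not_le)
    have "L > 0" using R0[of k] that by linarith
    have "I ?f L \<le> I ?f (R m) + ennreal (c * V L)"
      using n m \<open>R m \<le> L\<close> by (intro shell) auto
    also have "\<dots> \<le> ennreal (K + 2 * c * V (R m)) + ennreal (c * V L)"
      using at_R[OF m(2)] by (rule add_right_mono)
    also have "\<dots> = ennreal (K + 2 * c * V (R m) + c * V L)"
      using \<open>K \<ge> 0\<close> c V0[OF R0[of m]] V0[OF \<open>L > 0\<close>] by (intro ennreal_plus[symmetric]) auto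
    also have "\<dots> \<le> ennreal (K + 3 * c * V L)"
      using mult_left_mono[OF V_mono[OF R0[of m] \<open>R m \<le> L\<close>], of c] c by (intro ennreal_leI) (simp add: algebra_simps)
    finally show ?thesis .
  qed
  have "filterlim V at_top at_top"
    unfolding V_def
    by (intro filterlim_pow_at_top filterlim_tendsto_pos_mult_at_top[OF tendsto_const] filterlim_ident) auto
  then have "\<forall>\<^sub>F L in at_top. K / c \<le> V L"
    by (simp add: filterlim_at_top)
  with eventually_ge_at_top[of "R k"] show ?thesis
  proof eventually_elim
    case (elim L)
    have "L > 0" using R0[of k] elim(1) by linarith
    have "K + 3 * c * V L \<le> 4 * c * V L"
      using elim(2) c by (simp add: field_simps)
    then have "I ?f L \<le> ennreal (4 * c * V L)"
      using all[OF elim(1)] by (meson ennreal_leI order_trans)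
    then show ?case using \<open>L > 0\<close> c by (simp add: mean_iff)
  qed
qed

section \<open>Exponential families of the propagators, exhausting sets and radii\<close>

lemma exponential_family_spacetime:
  assumes "only_pair_resonances \<phi>"
  shows "exponential_family 4 (3 powr (1 / 4)) (\<lambda>\<xi> (t, x). cis (\<xi> * x - t * \<phi> \<xi>))"
proof
  fix \<Lambda> :: "real set" and b :: "real \<Rightarrow> complex"
  assume "finite \<Lambda>"
  from besicovitch_norm_is_propagated_sum[OF this assms, of b] obtain c where
    c: "besicovitch_norm_is 4 (\<lambda>(t, x). \<Sum>\<xi>\<in>\<Lambda>. b \<xi> * cis (\<xi> * x - t * \<phi> \<xi>)) c"
      "c \<le> 3 powr (1 / 4) * sqrt (\<Sum>\<xi>\<in>\<Lambda>. (norm (b \<xi>))\<^sup>2)" .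
  have "(\<lambda>(t, x). \<Sum>\<xi>\<in>\<Lambda>. b \<xi> * cis (\<xi> * x - t * \<phi> \<xi>)) =
      (\<lambda>y. \<Sum>\<xi>\<in>\<Lambda>. b \<xi> * (case y of (t, x) \<Rightarrow> cis (\<xi> * x - t * \<phi> \<xi>)))"
    by (simp add: fun_eq_iff)
  from c[unfolded this] show "\<exists>c. besicovitch_norm_is 4 (\<lambda>y. \<Sum>\<xi>\<in>\<Lambda>. b \<xi> * (case y of (t, x) \<Rightarrow> cis (\<xi> * x - t * \<phi> \<xi>))) c \<and>
      c \<le> 3 powr (1 / 4) * sqrt (\<Sum>\<xi>\<in>\<Lambda>. (norm (b \<xi>))\<^sup>2)"
    by (intro exI[of _ c] conjI)
qed simp_all

lemma exp_sum_phase: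
  "b * cis (\<xi> * x - s) = (b * cis (- s)) * cis (\<xi> * x)"
  by (simp add: cis_mult mult.assoc)

text \<open>At fixed time the evolution multiplies each coefficient by a number of modulus one, so
  Parseval applies with constant 1.\<close>

lemma exponential_family_slice: "exponential_family 2 1 (\<lambda>\<xi> x. cis (\<xi> * x - t * \<phi> \<xi>))"
proof
  fix \<Lambda> :: "real set" and b :: "real \<Rightarrow> complex"
  assume "finite \<Lambda>"
  from besicovitch_norm_is_exp_sum[OF this, of "\<lambda>\<xi>. b \<xi> * cis (- (t * \<phi> \<xi>))"]
  have "besicovitch_norm_is 2 (\<lambda>x. \<Sum>\<xi>\<in>\<Lambda>. b \<xi> * cis (\<xi> * x - t * \<phi> \<xi>)) (sqrt (\<Sum>\<xi>\<in>\<Lambda>. (norm (b \<xi>))\<^sup>2))"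
    by (simp only: exp_sum_phase norm_mult norm_cis mult_1_right)
  then show "\<exists>c. besicovitch_norm_is 2 (\<lambda>x. \<Sum>\<xi>\<in>\<Lambda>. b \<xi> * cis (\<xi> * x - t * \<phi> \<xi>)) c \<and>
      c \<le> 1 * sqrt (\<Sum>\<xi>\<in>\<Lambda>. (norm (b \<xi>))\<^sup>2)"
    by (intro exI[of _ "sqrt (\<Sum>\<xi>\<in>\<Lambda>. (norm (b \<xi>))\<^sup>2)"]) simp
qed simp_all

lemma exhausting_sets:
  fixes f :: "'i \<Rightarrow> real"
  assumes "\<And>i. f i \<ge> 0" "\<And>A. finite A \<Longrightarrow> sum f A \<le> B"
  obtains \<Lambda> :: "nat \<Rightarrow> 'i set" where "\<And>n. finite (\<Lambda> n)" "mono \<Lambda>"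
    "\<And>n A. finite A \<Longrightarrow> A \<inter> \<Lambda> n = {} \<Longrightarrow> sum f A < 1 / real (Suc n)"
proof -
  have "\<exists>A. finite A \<and> (\<forall>B. finite B \<longrightarrow> B \<inter> A = {} \<longrightarrow> sum f B < 1 / real (Suc n))" for n
    by (rule finite_set_small_tail[of f B "1 / real (Suc n)"]) (use assms in auto)
  then obtain T where T: "\<And>n. finite (T n)"
    "\<And>n B. finite B \<Longrightarrow> B \<inter> T n = {} \<Longrightarrow> sum f B < 1 / real (Suc n)"
    by metis
  show thesis
  proof
    show "finite (\<Union>k\<le>n. T k)" for n using T(1) by simp
    show "mono (\<lambda>n. \<Union>k\<le>n. T k)" by (rule monoI) force
    show "sum f A < 1 / real (Suc n)" if "finite A" "A \<inter> (\<Union>k\<le>n. T k) = {}" for n A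
      using that by (intro T(2)) auto
  qed
qed

lemma doubling_sequence:
  fixes P :: "nat \<Rightarrow> real \<Rightarrow> bool"
  assumes "\<And>n. eventually (P n) at_top"
  obtains R where "\<And>n. R n > 0" "\<And>n. 2 * R n \<le> R (Suc n)" "\<And>n L. R n \<le> L \<Longrightarrow> P n L"
proof -
  have "\<forall>n. \<exists>T. \<forall>L\<ge>T. P n L"
    using assms by (simp add: eventually_at_top_linorder)
  then obtain T where T: "\<And>n L. T n \<le> L \<Longrightarrow> P n L" by metis
  \<comment> \<open>The partial sums of |T k| increase and exceed T n, the power of 2 forces
    doubling, and the summand 1 keeps the radii positive.\<close>
  define R where "R n = 2 ^ n * (1 + (\<Sum>k\<le>n. \<bar>T k\<bar>))" for n :: nat
  show thesis
  proof
    have pos: "(\<Sum>k\<le>n. \<bar>T k\<bar>) \<ge> 0" for n by (intro sum_nonneg) auto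
    then show "R n > 0" for n by (simp add: R_def add_pos_nonneg)
    show "2 * R n \<le> R (Suc n)" for n
      using pos[of n] by (simp add: R_def mult_left_mono)
    have "T n \<le> R n" for n
    proof -
      have "T n \<le> (\<Sum>k\<le>n. \<bar>T k\<bar>)"
        using member_le_sum[of n "{..n}" "\<lambda>k. \<bar>T k\<bar>"] by auto
      also have "\<dots> \<le> R n"
        unfolding R_def using pos[of n] mult_mono[of 1 "2 ^ n :: real" "\<Sum>k\<le>n. \<bar>T k\<bar>" "1 + (\<Sum>k\<le>n. \<bar>T k\<bar>)"]
        by simp
      finally show ?thesis .
    qed
    then show "P n L" if "R n \<le> L" for n L using T that order_trans by blast
  qed
qed

lemma eventually_mean_le_trans:
  assumes le: "\<forall>\<^sub>F k in sequentially. \<forall>\<^sub>F L in at_top. m k (L :: real) \<le> ennreal (c k)"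
    and "\<And>\<epsilon>. \<epsilon> > 0 \<Longrightarrow> \<forall>\<^sub>F k in sequentially. c k < \<epsilon> powr p" and "\<epsilon> > (0::real)"
  shows "\<forall>\<^sub>F k in sequentially. \<forall>\<^sub>F L in at_top. m k L \<le> ennreal (\<epsilon> powr p)"
  using le assms(2)[OF assms(3)]
proof eventually_elim
  case (elim k)
  from elim(1) show ?case
  proof eventually_elim
    case (elim L)
    then show ?case
      using ennreal_leI[OF less_imp_le[OF \<open>c k < \<epsilon> powr p\<close>]] by (rule order_trans)
  qed
qed

section \<open>Construction of the propagator\<close>

text \<open>A Riesz-Fischer theorem in which one function has to serve two topologies at once:
  convergence in space-time and convergence on every single slice.\<close>

lemma propagator_exists:
  fixes a :: "real \<Rightarrow> complex" and \<phi> :: "real \<Rightarrow> real"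
  assumes \<phi>: "only_pair_resonances \<phi>"
    and a: "\<And>A. finite A \<Longrightarrow> (\<Sum>\<xi>\<in>A. (norm (a \<xi>))\<^sup>2) \<le> B"
  obtains F :: "real \<times> real \<Rightarrow> complex" where
    "has_besicovitch_sum 4 (\<lambda>\<xi> y. a \<xi> * (case y of (t, x) \<Rightarrow> cis (\<xi> * x - t * \<phi> \<xi>))) F"
    "\<And>t. has_besicovitch_sum 2 (\<lambda>\<xi> x. a \<xi> * cis (\<xi> * x - t * \<phi> \<xi>)) (\<lambda>x. F (t, x))"
proof -
  interpret E4: exponential_family 4 "3 powr (1 / 4)" "\<lambda>\<xi> (t, x). cis (\<xi> * x - t * \<phi> \<xi>)"
    by (rule exponential_family_spacetime[OF \<phi>])
  define \<eta> where "\<eta> n = 1 / real (Suc n)" for n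
  have \<eta>_pos: "\<eta> n > 0" for n by (simp add: \<eta>_def)
  have \<eta>_lim: "\<eta> \<longlonglongrightarrow> 0" unfolding \<eta>_def using LIMSEQ_inverse_real_of_nat by (simp add: inverse_eq_divide)
  obtain \<Lambda> :: "nat \<Rightarrow> real set" where fin: "\<And>n. finite (\<Lambda> n)" and "mono \<Lambda>"
    and tail: "\<And>n A. finite A \<Longrightarrow> A \<inter> \<Lambda> n = {} \<Longrightarrow> (\<Sum>\<xi>\<in>A. (norm (a \<xi>))\<^sup>2) < \<eta> n"
    unfolding \<eta>_def by (rule exhausting_sets[of "\<lambda>\<xi>. (norm (a \<xi>))\<^sup>2" B]) (use a in auto)
  have mono: "\<Lambda> k \<subseteq> \<Lambda> n" if "k \<le> n" for k n using monoD[OF \<open>mono \<Lambda>\<close> that] .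
  define e where "e \<xi> y = (case y of (t, x) \<Rightarrow> cis (\<xi> * x - t * \<phi> \<xi>))" for \<xi> :: real and y :: "real \<times> real"
  define S where "S n y = (\<Sum>\<xi>\<in>\<Lambda> n. a \<xi> * e \<xi> y)" for n y
  have S_diff: "S n y - S k y = (\<Sum>\<xi>\<in>\<Lambda> n - \<Lambda> k. a \<xi> * e \<xi> y)" if "k \<le> n" for n k y
    unfolding S_def using sum_diff[OF fin mono[OF that], of "\<lambda>\<xi>. a \<xi> * e \<xi> y"] by simp
  have tail_diff: "(\<Sum>\<xi>\<in>\<Lambda> n - \<Lambda> k. (norm (a \<xi>))\<^sup>2) < \<eta> k" for n k
    using fin by (intro tail) auto
  \<comment> \<open>By the bound for exponential sums this exceeds the limiting norm of every
    difference \<open>S n - S k\<close> with index k in place of n here.\<close>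
  define \<gamma> where "\<gamma> n = 3 powr (1 / 4) * sqrt (\<eta> n)" for n
  have \<gamma>_pos: "\<gamma> n > 0" for n using \<eta>_pos by (simp add: \<gamma>_def)
  have mean4: "\<forall>\<^sub>F L in at_top. besicovitch_mean 4 (\<lambda>y. S n y - S k y) L \<le> ennreal (\<gamma> k powr 4)"
    if "k \<le> n" for n k
  proof -
    have "finite (\<Lambda> n - \<Lambda> k)" using fin by simp
    from E4.exp_sum_bound[OF this, of a] obtain d where
      d: "besicovitch_norm_is 4 (\<lambda>y. \<Sum>\<xi>\<in>\<Lambda> n - \<Lambda> k. a \<xi> * e \<xi> y) d"
        "d \<le> 3 powr (1 / 4) * sqrt (\<Sum>\<xi>\<in>\<Lambda> n - \<Lambda> k. (norm (a \<xi>))\<^sup>2)"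
      unfolding e_def by (elim exE conjE)
    have "3 powr (1 / 4) * sqrt (\<Sum>\<xi>\<in>\<Lambda> n - \<Lambda> k. (norm (a \<xi>))\<^sup>2) < \<gamma> k"
      unfolding \<gamma>_def using tail_diff by (intro mult_strict_left_mono real_sqrt_less_mono) auto
    with d(2) have "d < \<gamma> k" by (rule le_less_trans)
    then show ?thesis
      unfolding S_diff[OF that] by (intro eventually_besicovitch_mean_le[OF _ d(1)]) simp_all
  qed
  have mean2: "\<forall>\<^sub>F L in at_top. \<forall>t. besicovitch_mean 2 (\<lambda>x. S n (t, x) - S k (t, x)) L \<le> ennreal (\<eta> k)"
    if "k \<le> n" for n k
  proof -
    have "finite (\<Lambda> n - \<Lambda> k)" using fin by simp
    from eventually_besicovitch_mean_exp_sum_le[OF this tail_diff]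
    show ?thesis
    proof eventually_elim
      case (elim L)
      have "besicovitch_mean 2 (\<lambda>x. \<Sum>\<xi>\<in>\<Lambda> n - \<Lambda> k. (a \<xi> * cis (- (t * \<phi> \<xi>))) * cis (\<xi> * x)) L \<le> ennreal (\<eta> k)" for t
        by (rule elim[rule_format]) (simp add: norm_mult)
      then show ?case
        unfolding S_diff[OF that] e_def prod.case exp_sum_phase by blast
    qed
  qed
  \<comment> \<open>Finitely many k for each n, so the conditions hold simultaneously for large L.
    The quantifier over t is inside, so the radii do not depend on time.\<close>
  define Q where "Q n L \<longleftrightarrow> (\<forall>k\<in>{..n}. besicovitch_mean 4 (\<lambda>y. S n y - S k y) L \<le> ennreal (\<gamma> k powr 4) \<and>
      (\<forall>t. besicovitch_mean 2 (\<lambda>x. S n (t, x) - S k (t, x)) L \<le> ennreal (\<eta> k)))" for n L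
  have "eventually (Q n) at_top" for n
    unfolding Q_def using mean4 mean2 by (intro eventually_ball_finite ballI eventually_conj) auto
  then obtain R where R0: "\<And>n. R n > 0" and R2: "\<And>n. 2 * R n \<le> R (Suc n)"
    and R: "\<And>n L. R n \<le> L \<Longrightarrow> Q n L"
    by (rule doubling_sequence[of Q]) metis
  note monoR = doubling_sequence_mono[of R, OF R0 R2]

  define r where "r y = max \<bar>fst y\<bar> \<bar>snd y\<bar>" for y :: "real \<times> real"
  \<comment> \<open>The index is that of the inner radius: \<open>S n\<close> is used for R n < r y
    \<le> R (n + 1), and \<open>S 0\<close> on the whole initial cube of radius R 1.\<close>
  define N where "N y = (LEAST n. r y \<le> R (Suc n))" for y
  define F where "F y = S (N y) y" for y
  have N_eq: "N y = n" if "r y \<le> R (Suc n)" "R n < r y" for y n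
    unfolding N_def
  proof (rule Least_equality)
    fix m assume "r y \<le> R (Suc m)"
    then show "n \<le> m" using monoR[of "Suc m" n] that(2) by (meson leD not_less_eq_eq order_trans)
  qed (rule that(1))
  have N_le: "N y \<le> k" if "r y \<le> R k" for y k
    unfolding N_def using that monoR[of k "Suc k"] by (intro Least_le) simp
  have S_borel[measurable]: "S n \<in> borel_measurable borel" for n
    unfolding S_def e_def case_prod_beta by (intro borel_measurable_continuous_onI continuous_intros)
  have [measurable]: "r \<in> borel_measurable borel"
    unfolding r_def by (intro borel_measurable_continuous_onI continuous_intros)
  have [measurable]: "N \<in> borel \<rightarrow>\<^sub>M count_space UNIV"
    unfolding N_def by measurable
  \<comment> \<open>Borel measurability is established first because it passes to every slice;
    Lebesgue measurability in the plane would not.\<close>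
  have F_borel: "F \<in> borel_measurable borel"
    unfolding F_def by (rule measurable_compose_countable[where f = S]) measurable
  have F_lebesgue: "F \<in> borel_measurable lebesgue" and S_lebesgue: "S n \<in> borel_measurable lebesgue" for n
    using F_borel S_borel by (auto intro!: measurable_completion)
  have slice: "(\<lambda>x. G (t, x)) \<in> borel_measurable lebesgue" if "G \<in> borel_measurable borel"
    for G :: "real \<times> real \<Rightarrow> complex" and t
  proof (intro measurable_completion)
    have "(\<lambda>x. (t, x)) \<in> borel \<rightarrow>\<^sub>M (borel :: (real \<times> real) measure)"
      by (intro borel_measurable_continuous_onI continuous_intros)
    from measurable_compose[OF this that] show "(\<lambda>x. G (t, x)) \<in> borel_measurable lborel"
      by simp
  qed
  \<comment> \<open>A crude uniform bound for the partial sums up to index n. It controls F on a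
    bounded cube, where only finitely many of them occur.\<close>
  define A where "A n = (\<Sum>\<xi>\<in>\<Lambda> n. norm (a \<xi>))" for n
  have S_le: "norm (S m y) \<le> A n" if "m \<le> n" for m n y
  proof -
    have "norm (S m y) \<le> (\<Sum>\<xi>\<in>\<Lambda> m. norm (a \<xi>))"
      unfolding S_def by (rule sum_norm_le) (simp add: norm_mult e_def case_prod_beta)
    also have "\<dots> \<le> A n"
      unfolding A_def using fin mono[OF that] by (intro sum_mono2) auto
    finally show ?thesis .
  qed
  have F_S: "norm (F y - S k y) \<le> A k + A k" if "r y \<le> R k" for y k
    using norm_triangle_ineq4[of "F y" "S k y"] S_le[OF N_le[OF that], of y] S_le[OF order_refl, of k y]
    unfolding F_def by linarith
  have in_cube2: "y \<in> cube L \<longleftrightarrow> r y \<le> L" for y :: "real \<times> real" and L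
    unfolding cube_plane r_def by (cases y) auto
  have in_cube1: "x \<in> cube L \<longleftrightarrow> \<bar>x\<bar> \<le> L" for x L :: real
    by auto

  show thesis
  proof
    have "\<forall>\<^sub>F L in at_top. besicovitch_mean 4 (\<lambda>y. F y - S k y) L \<le> ennreal (4 * \<gamma> k powr 4)" for k
    proof (rule besicovitch_mean_patched_le[where R = R and B = "A k + A k"])
      show "F y = S n y" if "y \<in> cube (R (Suc n))" "y \<notin> cube (R n)" for n y
        using that unfolding in_cube2 F_def by (subst N_eq[of y n]) auto
      show "norm (F y - S k y) \<le> A k + A k" if "y \<in> cube (R k)" for y
        using that unfolding in_cube2 by (rule F_S)
      show "besicovitch_mean 4 (\<lambda>y. S n y - S k y) L \<le> ennreal (\<gamma> k powr 4)" if "k \<le> n" "R n \<le> L" for n L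
        using R[OF that(2)] that(1) by (simp add: Q_def)
    qed (use R0 R2 \<gamma>_pos[of k] F_lebesgue S_lebesgue in simp_all)
    moreover have "\<forall>\<^sub>F k in sequentially. 4 * \<gamma> k powr 4 < \<epsilon> powr 4" if "\<epsilon> > 0" for \<epsilon>
    proof (rule order_tendstoD(2))
      have "(\<lambda>k. 4 * \<gamma> k powr 4) \<longlonglongrightarrow> 4 * (3 powr (1 / 4) * sqrt 0) powr 4"
        unfolding \<gamma>_def using \<eta>_pos[THEN less_imp_le] by (intro tendsto_intros tendsto_powr' \<eta>_lim) auto
      then show "(\<lambda>k. 4 * \<gamma> k powr 4) \<longlonglongrightarrow> 0" by simp
    qed (use that in simp)
    ultimately have "\<forall>\<^sub>F k in sequentially. \<forall>\<^sub>F L in at_top.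
        besicovitch_mean 4 (\<lambda>y. F y - S k y) L \<le> ennreal (\<epsilon> powr 4)" if "\<epsilon> > 0" for \<epsilon>
      by (rule eventually_mean_le_trans[OF always_eventually[OF allI] _ that])
    then show "has_besicovitch_sum 4 (\<lambda>\<xi> y. a \<xi> * (case y of (t, x) \<Rightarrow> cis (\<xi> * x - t * \<phi> \<xi>))) F"
      unfolding S_def e_def using tail[THEN less_imp_le] F_lebesgue fin \<eta>_lim
      by (intro E4.has_besicovitch_sumI[where \<Lambda> = \<Lambda> and \<eta> = \<eta>])
  next
    fix t
    interpret E2: exponential_family 2 1 "\<lambda>\<xi> x. cis (\<xi> * x - t * \<phi> \<xi>)"
      by (rule exponential_family_slice)
    \<comment> \<open>Once the radii exceed |t|, the point (t, x) crosses a shell boundary exactly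
      when x does, so the slice is patched with the same radii. Smaller k are covered by the
      eventual quantifier.\<close>
    obtain k0 where k0: "\<bar>t\<bar> < R k0"
      using doubling_sequence_unbounded[of R, OF R0 R2] by blast
    have "\<forall>\<^sub>F L in at_top. besicovitch_mean 2 (\<lambda>x. F (t, x) - S k (t, x)) L \<le> ennreal (4 * \<eta> k)"
      if "k0 \<le> k" for k
    proof (rule besicovitch_mean_patched_le[where R = R and B = "A k + A k" and S = "\<lambda>n x. S n (t, x)"])
      have t: "\<bar>t\<bar> \<le> R n" if "k \<le> n" for n
        using k0 monoR[of k0 n] \<open>k0 \<le> k\<close> that by linarith
      show "F (t, x) = S n (t, x)" if "k \<le> n" "x \<in> cube (R (Suc n))" "x \<notin> cube (R n)" for n x
      proof -
        have "r (t, x) \<le> R (Suc n)" "R n < r (t, x)"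
          using that(2,3) t[of n] t[of "Suc n"] that(1) unfolding in_cube1 r_def by auto
        then show ?thesis unfolding F_def by (simp add: N_eq)
      qed
      show "norm (F (t, x) - S k (t, x)) \<le> A k + A k" if "x \<in> cube (R k)" for x
        using that t[of k] unfolding in_cube1 by (intro F_S) (auto simp: r_def)
      show "besicovitch_mean 2 (\<lambda>x. S n (t, x) - S k (t, x)) L \<le> ennreal (\<eta> k)" if "k \<le> n" "R n \<le> L" for n L
        using R[OF that(2)] that(1) by (simp add: Q_def)
    qed (use R0 R2 \<eta>_pos[of k] slice[OF F_borel] slice[OF S_borel] in simp_all)
    then have "\<forall>\<^sub>F k in sequentially. \<forall>\<^sub>F L in at_top. besicovitch_mean 2 (\<lambda>x. F (t, x) - S k (t, x)) L \<le> ennreal (4 * \<eta> k)"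
      by (rule eventually_sequentiallyI)
    moreover have "\<forall>\<^sub>F k in sequentially. 4 * \<eta> k < \<epsilon> powr 2" if "\<epsilon> > 0" for \<epsilon>
      by (rule order_tendstoD(2)[OF tendsto_mult_right_zero[OF \<eta>_lim]]) (use that in simp)
    ultimately have "\<forall>\<^sub>F k in sequentially. \<forall>\<^sub>F L in at_top.
        besicovitch_mean 2 (\<lambda>x. F (t, x) - S k (t, x)) L \<le> ennreal (\<epsilon> powr 2)" if "\<epsilon> > 0" for \<epsilon>
      by (rule eventually_mean_le_trans[OF _ _ that])
    then show "has_besicovitch_sum 2 (\<lambda>\<xi> x. a \<xi> * cis (\<xi> * x - t * \<phi> \<xi>)) (\<lambda>x. F (t, x))"
      unfolding S_def e_def prod.case using tail[THEN less_imp_le] slice[OF F_borel] fin \<eta>_lim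
      by (intro E2.has_besicovitch_sumI[where \<Lambda> = \<Lambda> and \<eta> = \<eta>])
  qed
qed

section \<open>The Strichartz estimates\<close>

text \<open>Bessel's inequality supplies the coefficient bound for both halves. The second half
  concerns every representative of the series, and the first guarantees that there is one with the
  correct time slices.\<close>

lemma strichartz_estimate:
  assumes \<phi>: "only_pair_resonances \<phi>" and u: "u \<in> besicovitch_ap2"
  shows "\<exists>F. is_spacetime_propagator \<phi> u F \<and> (\<forall>t. is_propagator_at \<phi> u t (\<lambda>x. F (t, x)))"
    and "is_spacetime_propagator \<phi> u F \<Longrightarrow>
      has_besicovitch_norm 4 F \<and> besicovitch_norm 4 F \<le> 3 powr (1 / 4) * besicovitch_norm 2 u"
proof -
  interpret E4: exponential_family 4 "3 powr (1 / 4)" "\<lambda>\<xi> (t, x). cis (\<xi> * x - t * \<phi> \<xi>)"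
    by (rule exponential_family_spacetime[OF \<phi>])
  have eq: "propagator_term \<phi> u = (\<lambda>\<xi> y. bohr_fourier u \<xi> * (case y of (t, x) \<Rightarrow> cis (\<xi> * x - t * \<phi> \<xi>)))"
    by (simp add: propagator_term_def fun_eq_iff)
  obtain G where G: "has_besicovitch_sum 4 (\<lambda>\<xi> y. bohr_fourier u \<xi> * (case y of (t, x) \<Rightarrow> cis (\<xi> * x - t * \<phi> \<xi>))) G"
    "\<And>t. has_besicovitch_sum 2 (\<lambda>\<xi> x. bohr_fourier u \<xi> * cis (\<xi> * x - t * \<phi> \<xi>)) (\<lambda>x. G (t, x))"
    by (rule propagator_exists[OF \<phi> bessel_inequality[OF u]]) (assumption, rule that, assumption+)
  show "\<exists>F. is_spacetime_propagator \<phi> u F \<and> (\<forall>t. is_propagator_at \<phi> u t (\<lambda>x. F (t, x)))"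
    unfolding is_spacetime_propagator_def is_propagator_at_def eq prod.case
    by (rule exI[of _ G], rule conjI[OF G(1)], rule allI, rule G(2))
  assume "is_spacetime_propagator \<phi> u F"
  then have sum: "has_besicovitch_sum 4 (\<lambda>\<xi> y. bohr_fourier u \<xi> * (case y of (t, x) \<Rightarrow> cis (\<xi> * x - t * \<phi> \<xi>))) F"
    unfolding is_spacetime_propagator_def eq .
  have "besicovitch_norm 2 u \<ge> 0"
    by (rule besicovitch_norm_isD(3)[OF _ besicovitch_ap2_norm[OF u]]) simp
  note bound = E4.has_besicovitch_sum_bound[OF sum this bessel_inequality[OF u]]
  show "has_besicovitch_norm 4 F \<and> besicovitch_norm 4 F \<le> 3 powr (1 / 4) * besicovitch_norm 2 u"
    by (rule conjI[OF bound])
qed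

lemma strichartz_constant:
  assumes "only_pair_resonances \<phi>"
  shows "\<exists>K::real. \<forall>u0\<in>besicovitch_ap2.
      (\<exists>F. is_spacetime_propagator \<phi> u0 F \<and> (\<forall>t. is_propagator_at \<phi> u0 t (\<lambda>x. F (t, x)))) \<and>
      (\<forall>F. is_spacetime_propagator \<phi> u0 F \<longrightarrow>
           has_besicovitch_norm 4 F \<and> besicovitch_norm 4 F \<le> K * besicovitch_norm 2 u0)"
proof (rule exI[of _ "3 powr (1 / 4)"], rule ballI, rule conjI)
  fix u assume u: "u \<in> besicovitch_ap2"
  show "\<exists>F. is_spacetime_propagator \<phi> u F \<and> (\<forall>t. is_propagator_at \<phi> u t (\<lambda>x. F (t, x)))"
    by (rule strichartz_estimate(1)[OF assms u])
  show "\<forall>F. is_spacetime_propagator \<phi> u F \<longrightarrow>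
      has_besicovitch_norm 4 F \<and> besicovitch_norm 4 F \<le> 3 powr (1 / 4) * besicovitch_norm 2 u"
    by (rule allI, rule impI, rule strichartz_estimate(2)[OF assms u])
qed

theorem theorem1p2:
  "(\<exists>K::real. \<forall>u0\<in>besicovitch_ap2.
      (\<exists>F. is_spacetime_propagator (\<lambda>\<xi>. \<xi> ^ 2) u0 F \<and>
           (\<forall>t. is_propagator_at (\<lambda>\<xi>. \<xi> ^ 2) u0 t (\<lambda>x. F (t, x)))) \<and>
      (\<forall>F. is_spacetime_propagator (\<lambda>\<xi>. \<xi> ^ 2) u0 F \<longrightarrow>
           has_besicovitch_norm 4 F \<and> besicovitch_norm 4 F \<le> K * besicovitch_norm 2 u0)) \<and>
   (\<exists>K::real. \<forall>u0\<in>besicovitch_ap2.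
      (\<exists>F. is_spacetime_propagator (\<lambda>\<xi>. \<xi> ^ 3) u0 F \<and>
           (\<forall>t. is_propagator_at (\<lambda>\<xi>. \<xi> ^ 3) u0 t (\<lambda>x. F (t, x)))) \<and>
      (\<forall>F. is_spacetime_propagator (\<lambda>\<xi>. \<xi> ^ 3) u0 F \<longrightarrow>
           has_besicovitch_norm 4 F \<and> besicovitch_norm 4 F \<le> K * besicovitch_norm 2 u0))"
  by (rule conjI[OF strichartz_constant[OF only_pair_resonances_square] strichartz_constant[OF only_pair_resonances_cube]])

end
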